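(* In the mixed-integer setting of the context, the branch-and-cut algorithm with certification described there terminates finitely almost surely. In addition, with probability at least $1-\varepsilon_{\mathrm{false}}$, its returned solution $(x^\star,\theta^\star)$ satisfies $$0\le\big(f(x^\star)+\theta^\star\big)-F^\star\le\varepsilon_{\mathrm{opt}}.$$
   Context: Problem. $F^\star:=\min_{x\in\mathcal X}\{f(x)+\max_{i\in\mathcal I}Q(x,\xi^{(i)})\}$, where $\mathcal X\subseteq\mathbb Z^{d_z}\times\mathbb R^{d_x-d_z}$, $x=(x_z,x_c)$ with $x_z$ integer and $x_c$ continuous, $\mathcal I$ is finite with $|\mathcal I|\ge2$, and $Q(x,\xi)=\min_y\{b^\top y:Gy+Ex+U\xi-h\ge0\}$ is finite for all $x\in\mathcal X$ and all scenarios $\xi^{(i)}$. Let $\Pi=\{\pi\ge0:G^\top\pi=b\}$, so $Q(x,\xi^{(i)})=\max_{\pi\in\Pi}\pi^\top(h-Ex-U\xi^{(i)})$. Let $Q^\star(x)=\max_iQ(x,\xi^{(i)})$ and $I^\star(x)=\operatorname{argmax}_{i}Q(x,\xi^{(i)})$. Scores and kernels. Scores $\widehat Q_x:\mathcal I\to\mathbb R$ satisfy $|\widehat Q_x(i)-Q(x,\xi^{(i)})|\le\varepsilon$ and $|\widehat Q_x(i)-\widehat Q_{x'}(i)|\le L_Q'\|x-x'\|$ ($L_Q'>0$). $P_x$ is a Markov kernel on $\mathcal I$ with invariant distribution $p_x^w(i)\propto\exp(\widehat Q_x(i)/w)$, Lipschitz in $x$ in total variation ($\sup_I\|P_x(I,\cdot)-P_y(I,\cdot)\|_{\mathrm{TV}}\le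 L_P\|x-y\|$, where $\|\mu-\lambda\|_{\mathrm{TV}}=\sup_B|\mu(B)-\lambda(B)|$), with $\sup_{I,J}\|P_x(I,\cdot)-P_x(J,\cdot)\|_{\mathrm{TV}}\le\bar\eta$ for all $x$, $\bar\eta\in(0,1)$. There is $\Delta_\star>4\varepsilon$ with $Q^\star(x)-\max_{j\notin I^\star(x)}Q(x,\xi^{(j)})\ge\Delta_\star$ at every incumbent $x$ at which the oracle is called. The temperature satisfies $0<w\le(\Delta_\star-2\varepsilon)/\log\big(2(|\mathcal I|-1)/(1-\bar\eta)\big)$. Fix $p>0$, $c_0>0$, $\varepsilon_{\mathrm{false}}\in(0,1)$, $\varepsilon_{\mathrm{opt}}>0$. Define $$g(\kappa):=\max\Big\{1,\Big\lceil\frac{p\log(\max\{\kappa,1\})-\log\big(\frac{2c_0\bar\eta L_Q'}{\Delta_\star-4\varepsilon}\big)}{|\log\bar\eta|}\Big\rceil\Big\},\qquad C_{\bar\eta,p}:=\frac1{1-\bar\eta}\Big[2^p+\bar\eta^{-1/2}\Big(\frac{2p}{e|\log\bar\eta|}\Big)^p\Big],$$ $$\widehat\delta(\kappa):=\frac{|\mathcal I|-1}{1-\bar\eta}e^{-(\Delta_\star-2\varepsilon)/w}+\bar\eta^{\kappa-1}+\frac{2c_0\bar\eta L_Q'}{\Delta_\star-4\varepsilon}C_{\bar\eta,p}\kappa^{-p},\qquad\rho:=\bar\eta+(|\mathcal I|-1)e^{-(\Delta_\star-2\varepsilon)/w}\ (<1).$$ Adaptive soft-separation oracle. For each integer assignment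 $\bar x_z$ it maintains $\mathbf{state}(\bar x_z)\in\mathcal I$, $\mathbf{ref}(\bar x_z)$ (continuous part of the last incumbent) and a call counter $\kappa(\bar x_z)$. At input $(\bar x,\bar\theta)$ with $\bar x=(\bar x_z,\bar x_c)$: if $\bar x_z$ is new, initialize $\mathbf{state}(\bar x_z)\in\mathcal I$, $\mathbf{ref}(\bar x_z)=\bar x_c$, $\kappa(\bar x_z)=0$. Let $m=1$ if $\kappa(\bar x_z)=0$ or $\|\bar x_c-\mathbf{ref}(\bar x_z)\|\le c_0\max\{\kappa(\bar x_z),1\}^{-p}$, otherwise $m=g(\kappa(\bar x_z))$. Sample $I\sim P_{\bar x}^m(\mathbf{state}(\bar x_z),\cdot)$ (conditionally on the past). The returned cut is $\theta\ge\bar\pi^\top(h-Ex-U\xi^{(I)})$ with $\bar\pi\in\operatorname{argmax}_{\pi\in\Pi}\pi^\top(h-E\bar x-U\xi^{(I)})$ (an extreme point of $\Pi$); it is reported violated iff $Q(\bar x,\xi^{(I)})>\bar\theta$. Then set $\mathbf{state}(\bar x_z)\leftarrow I$, $\mathbf{ref}(\bar x_z)\leftarrow\bar x_c$, $\kappa(\bar x_z)\leftarrow\kappa(\bar x_z)+1$. Branch-and-cut with certification. Maintain a pool $\mathcal C$ of cuts (initially a finite set of valid cuts), and let $L(\mathcal C)$ be the global lower bound of a branch-and-bound tree for the master problem $\min\{f(x)+\theta:\ x\in\mathcal X,\ \theta\ge\pi^\top(h-Ex-U\xi^{(i)})\ \forall(i,\pi)\in\mathcal C\}$ (cuts being added lazily).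 Start with $\widehat U=+\infty$. While $\widehat U-L(\mathcal C)>\varepsilon_{\mathrm{opt}}$, continue branch-and-bound; for each integer incumbent $(\bar x,\bar\theta)$ encountered: (a) if the Markov chain of $\bar x_z$ has no label, give it the next unused label in $j=1,2,\dots$; let $j$ be its label; (b) call the oracle once at $(\bar x,\bar\theta)$, then let $k=\kappa(\bar x_z)$ and $r=\frac{j(j+1)k(k+1)}{\varepsilon_{\mathrm{false}}}\min\{1,\widehat\delta(k)\}$; (c) repeat: if the last call returned a violated cut, add it to $\mathcal C$ and stop processing this incumbent; else if $r\le1$, certify the incumbent: if $f(\bar x)+\bar\theta<\widehat U$, set $\widehat U\leftarrow f(\bar x)+\bar\theta$ and $(x^\star,\theta^\star)\leftarrow(\bar x,\bar\theta)$, and stop processing this incumbent; else call the oracle again at $(\bar x,\bar\theta)$ and set $r\leftarrow\rho r$. On termination return $(x^\star,\theta^\star)$. The underlying branch-and-bound is exact with a tree of finite size (an incumbent is either cut off by a new cut or accepted, and when no open node remains the lower bound equals the best accepted value). *)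

theory Defs
  imports "HOL-Probability.Probability"
begin
text \<open>
  The first-stage variable lives in \<^typ>\<open>real ^ 'n\<close>; \<open>int_vars\<close> is the set of its integer
  coordinates, so every split of the coordinates (also a purely continuous or purely integer one)
  is covered.  The scenario index set is the finite type \<^typ>\<open>'i\<close>.
\<close>

record ('n::finite, 'y::finite, 'r::finite, 'u::finite, 'i::finite) two_stage =
  feas :: "(real ^ 'n) set"
  int_vars :: "'n set"
  obj :: "real ^ 'n \<Rightarrow> real"
  b_vec :: "real ^ 'y"
  G_mat :: "real ^ 'y ^ 'r"
  E_mat :: "real ^ 'n ^ 'r"
  U_mat :: "real ^ 'u ^ 'r"
  h_vec :: "real ^ 'r"
  scen :: "'i \<Rightarrow> real ^ 'u"

text \<open>
  \<open>x = (x\<^sub>z, x\<^sub>c)\<close>: both parts are kept as vectors of the full dimension, padded with zeros;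
  this preserves equality of integer parts and norms of differences of continuous parts.
\<close>

definition z_part :: "('n::finite, 'y::finite, 'r::finite, 'u::finite, 'i::finite) two_stage
    \<Rightarrow> real ^ 'n \<Rightarrow> real ^ 'n" where
  "z_part D x = (\<chi> i. if i \<in> int_vars D then x $ i else 0)"

definition c_part :: "('n::finite, 'y::finite, 'r::finite, 'u::finite, 'i::finite) two_stage
    \<Rightarrow> real ^ 'n \<Rightarrow> real ^ 'n" where
  "c_part D x = (\<chi> i. if i \<in> int_vars D then 0 else x $ i)"

definition recourse_set :: "('n::finite, 'y::finite, 'r::finite, 'u::finite, 'i::finite) two_stage
    \<Rightarrow> real ^ 'n \<Rightarrow> real ^ 'u \<Rightarrow> (real ^ 'y) set" where
  "recourse_set D x \<xi> = {y. 0 \<le> G_mat D *v y + E_mat D *v x + U_mat D *v \<xi> - h_vec D}"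

text \<open>
  The value of the recourse linear program.  It is finite iff the program is feasible and bounded
  below; the infimum of a linear program is then attained.
\<close>

definition Q :: "('n::finite, 'y::finite, 'r::finite, 'u::finite, 'i::finite) two_stage
    \<Rightarrow> real ^ 'n \<Rightarrow> real ^ 'u \<Rightarrow> real" where
  "Q D x \<xi> = (INF y\<in>recourse_set D x \<xi>. b_vec D \<bullet> y)"

definition Q_finite :: "('n::finite, 'y::finite, 'r::finite, 'u::finite, 'i::finite) two_stage
    \<Rightarrow> real ^ 'n \<Rightarrow> real ^ 'u \<Rightarrow> bool" where
  "Q_finite D x \<xi> \<longleftrightarrow>
     recourse_set D x \<xi> \<noteq> {} \<and> bdd_below ((\<lambda>y. b_vec D \<bullet> y) ` recourse_set D x \<xi>)"

definition Q_star :: "('n::finite, 'y::finite, 'r::finite, 'u::finite, 'i::finite) two_stage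
    \<Rightarrow> real ^ 'n \<Rightarrow> real" where
  "Q_star D x = Max (range (\<lambda>i. Q D x (scen D i)))"

definition I_star :: "('n::finite, 'y::finite, 'r::finite, 'u::finite, 'i::finite) two_stage
    \<Rightarrow> real ^ 'n \<Rightarrow> 'i set" where
  "I_star D x = {i. is_arg_max (\<lambda>i. Q D x (scen D i)) (\<lambda>_. True) i}"

definition F_star :: "('n::finite, 'y::finite, 'r::finite, 'u::finite, 'i::finite) two_stage
    \<Rightarrow> real" where
  "F_star D = (INF x\<in>feas D. obj D x + Q_star D x)"

definition dual_poly :: "('n::finite, 'y::finite, 'r::finite, 'u::finite, 'i::finite) two_stage
    \<Rightarrow> (real ^ 'r) set" where
  "dual_poly D = {\<pi>. 0 \<le> \<pi> \<and> transpose (G_mat D) *v \<pi> = b_vec D}"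

definition cut_val :: "('n::finite, 'y::finite, 'r::finite, 'u::finite, 'i::finite) two_stage
    \<Rightarrow> 'i \<Rightarrow> real ^ 'r \<Rightarrow> real ^ 'n \<Rightarrow> real" where
  "cut_val D i \<pi> x = \<pi> \<bullet> (h_vec D - E_mat D *v x - U_mat D *v scen D i)"

definition valid_cut :: "('n::finite, 'y::finite, 'r::finite, 'u::finite, 'i::finite) two_stage
    \<Rightarrow> 'i \<times> (real ^ 'r) \<Rightarrow> bool" where
  "valid_cut D c \<longleftrightarrow> (\<forall>x\<in>feas D. cut_val D (fst c) (snd c) x \<le> Q_star D x)"

definition master_feasible :: "('n::finite, 'y::finite, 'r::finite, 'u::finite, 'i::finite) two_stage
    \<Rightarrow> ('i \<times> (real ^ 'r)) set \<Rightarrow> real ^ 'n \<Rightarrow> real \<Rightarrow> bool" where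
  "master_feasible D C x \<theta> \<longleftrightarrow> x \<in> feas D \<and> (\<forall>(i, \<pi>)\<in>C. cut_val D i \<pi> x \<le> \<theta>)"

record ('n::finite, 'i::finite) oracle_spec =
  score :: "real ^ 'n \<Rightarrow> 'i \<Rightarrow> real"
  kern :: "real ^ 'n \<Rightarrow> 'i \<Rightarrow> 'i pmf"
  temp :: real
  eps :: real
  L_Q :: real
  eta :: real
  Delta :: real
  decay :: real
  c0 :: real
  eps_false :: real
  eps_opt :: real

definition tv_dist :: "'a pmf \<Rightarrow> 'a pmf \<Rightarrow> real" where
  "tv_dist \<mu> \<nu> = (SUP B. \<bar>measure_pmf.prob \<mu> B - measure_pmf.prob \<nu> B\<bar>)"

definition softmax :: "('n::finite, 'i::finite) oracle_spec \<Rightarrow> real ^ 'n \<Rightarrow> 'i \<Rightarrow> real" where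
  "softmax A x i = exp (score A x i / temp A) / (\<Sum>j\<in>UNIV. exp (score A x j / temp A))"

definition kernel_invariant :: "('i::finite \<Rightarrow> 'i pmf) \<Rightarrow> ('i \<Rightarrow> real) \<Rightarrow> bool" where
  "kernel_invariant K q \<longleftrightarrow> (\<forall>i. (\<Sum>j\<in>UNIV. q j * pmf (K j) i) = q i)"

fun kernel_pow :: "('i \<Rightarrow> 'i pmf) \<Rightarrow> nat \<Rightarrow> 'i \<Rightarrow> 'i pmf" where
  "kernel_pow K 0 i = return_pmf i"
| "kernel_pow K (Suc m) i = bind_pmf (kernel_pow K m i) K"

definition drift_const :: "('n::finite, 'i::finite) oracle_spec \<Rightarrow> real" where
  "drift_const A = 2 * c0 A * eta A * L_Q A / (Delta A - 4 * eps A)"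

definition g :: "('n::finite, 'i::finite) oracle_spec \<Rightarrow> nat \<Rightarrow> nat" where
  "g A \<kappa> = nat (max 1 \<lceil>(decay A * ln (max (real \<kappa>) 1) - ln (drift_const A)) / \<bar>ln (eta A)\<bar>\<rceil>)"

definition C_const :: "('n::finite, 'i::finite) oracle_spec \<Rightarrow> real" where
  "C_const A = 1 / (1 - eta A) *
     (2 powr decay A +
      eta A powr (- 1 / 2) * (2 * decay A / (exp 1 * \<bar>ln (eta A)\<bar>)) powr decay A)"

definition gibbs_tail :: "('n::finite, 'i::finite) oracle_spec \<Rightarrow> real" where
  "gibbs_tail A = (real CARD('i) - 1) * exp (- (Delta A - 2 * eps A) / temp A)"

text \<open>Only used at call counts \<open>\<kappa> \<ge> 1\<close>.\<close>

definition delta_hat :: "('n::finite, 'i::finite) oracle_spec \<Rightarrow> nat \<Rightarrow> real" where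
  "delta_hat A \<kappa> = gibbs_tail A / (1 - eta A) + eta A ^ (\<kappa> - 1)
     + drift_const A * C_const A * real \<kappa> powr (- decay A)"

definition rho :: "('n::finite, 'i::finite) oracle_spec \<Rightarrow> real" where
  "rho A = eta A + gibbs_tail A"

record ('x, 'i) chain =
  cur :: 'i
  ref_pt :: 'x
  calls :: nat

text \<open>
  \<open>Processing v x \<theta> q\<close>: the incumbent \<open>(x, \<theta>)\<close> found at the tree node \<open>v\<close> is being processed
  and the next action is an oracle call; \<open>q = None\<close> before the first call, afterwards \<open>q = Some r\<close>
  with \<open>r\<close> the current value of the risk bound.
\<close>

datatype 'x phase = Explore | Processing nat 'x real "real option"

text \<open>
  The branch-and-bound tree has natural numbers as node names.  \<open>created\<close> collects all nodes
  generated so far and \<open>opn\<close> the open ones; a node \<open>v\<close> stands for the subproblem of the master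
  problem restricted to \<open>region v\<close>, with lower bound \<open>bound v\<close>.  Labels and chains are indexed by
  integer assignments.
\<close>

record ('x, 'd, 'i) bc_state =
  pool :: "('i \<times> 'd) set"
  created :: "nat set"
  opn :: "nat set"
  region :: "nat \<Rightarrow> 'x set"
  bound :: "nat \<Rightarrow> ereal"
  upper :: ereal
  best :: "('x \<times> real) option"
  labels :: "'x \<Rightarrow> nat option"
  chains :: "'x \<Rightarrow> ('x, 'i) chain option"
  phase :: "'x phase"

text \<open>
  The infimum over no open nodes is \<open>\<infinity>\<close>, so without open nodes the global lower bound is the best
  accepted value.
\<close>

definition lower :: "('x, 'd, 'i) bc_state \<Rightarrow> ereal" where
  "lower s = min (upper s) (INF v\<in>opn s. bound s v)"

definition stopped :: "('n::finite, 'i::finite) oracle_spec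
    \<Rightarrow> (real ^ 'n, 'd, 'i) bc_state \<Rightarrow> bool" where
  "stopped A s \<longleftrightarrow> phase s = Explore \<and> \<not> upper s - lower s > ereal (eps_opt A)"

definition bounds_valid :: "('n::finite, 'y::finite, 'r::finite, 'u::finite, 'i::finite) two_stage
    \<Rightarrow> (real ^ 'n, real ^ 'r, 'i) bc_state \<Rightarrow> bool" where
  "bounds_valid D s \<longleftrightarrow>
     (\<forall>v\<in>opn s. \<forall>x \<theta>. x \<in> region s v \<and> master_feasible D (pool s) x \<theta>
        \<longrightarrow> bound s v \<le> ereal (obj D x + \<theta>))"

text \<open>
  The open node \<open>v\<close> is closed and replaced by the finite set \<open>W\<close> of new nodes.  Exactness: every
  master solution of \<open>v\<close> is inherited by a child unless it is no better than the best accepted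
  value.  Thus \<open>W = {}\<close> is fathoming (by infeasibility, by bound, or because an optimal solution
  of the node has just been accepted) and \<open>W \<noteq> {}\<close> is branching.
\<close>

definition node_replaced :: "('n::finite, 'y::finite, 'r::finite, 'u::finite, 'i::finite) two_stage
    \<Rightarrow> nat \<Rightarrow> nat set \<Rightarrow> (real ^ 'n, real ^ 'r, 'i) bc_state
    \<Rightarrow> (real ^ 'n, real ^ 'r, 'i) bc_state \<Rightarrow> bool" where
  "node_replaced D v W s s' \<longleftrightarrow>
     v \<in> opn s \<and> finite W \<and> W \<inter> created s = {} \<and>
     created s' = created s \<union> W \<and> opn s' = (opn s - {v}) \<union> W \<and>
     (\<forall>u\<in>created s. region s' u = region s u) \<and>
     (\<forall>x \<theta>. x \<in> region s v \<and> master_feasible D (pool s) x \<theta> \<longrightarrow>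
        (\<exists>w\<in>W. x \<in> region s' w) \<or> upper s' \<le> ereal (obj D x + \<theta>)) \<and>
     bounds_valid D s'"

definition bc_init :: "('n::finite, 'y::finite, 'r::finite, 'u::finite, 'i::finite) two_stage
    \<Rightarrow> (real ^ 'n, real ^ 'r, 'i) bc_state \<Rightarrow> bool" where
  "bc_init D s \<longleftrightarrow>
     finite (pool s) \<and> (\<forall>c\<in>pool s. valid_cut D c) \<and>
     created s = {0} \<and> opn s = {0} \<and> feas D \<subseteq> region s 0 \<and> bounds_valid D s \<and>
     upper s = \<infinity> \<and> best s = None \<and>
     labels s = Map.empty \<and> chains s = Map.empty \<and> phase s = Explore"

definition call_steps :: "('n::finite, 'y::finite, 'r::finite, 'u::finite, 'i::finite) two_stage
    \<Rightarrow> ('n, 'i) oracle_spec \<Rightarrow> (real ^ 'n, 'i) chain \<Rightarrow> real ^ 'n \<Rightarrow> nat" where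
  "call_steps D A c x =
     (if calls c = 0 \<or> norm (c_part D x - ref_pt c) \<le> c0 A * real (max (calls c) 1) powr (- decay A)
      then 1 else g A (calls c))"

definition call_law :: "('n::finite, 'y::finite, 'r::finite, 'u::finite, 'i::finite) two_stage
    \<Rightarrow> ('n, 'i) oracle_spec \<Rightarrow> (real ^ 'n, real ^ 'r, 'i) bc_state \<Rightarrow> real ^ 'n \<Rightarrow> 'i pmf" where
  "call_law D A s x =
     (let c = the (chains s (z_part D x)) in kernel_pow (kern A x) (call_steps D A c x) (cur c))"

definition after_call :: "('n::finite, 'y::finite, 'r::finite, 'u::finite, 'i::finite) two_stage
    \<Rightarrow> (real ^ 'n, real ^ 'r, 'i) bc_state \<Rightarrow> real ^ 'n \<Rightarrow> 'i
    \<Rightarrow> (real ^ 'n, real ^ 'r, 'i) bc_state" where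
  "after_call D s x i = s\<lparr>chains := (chains s)(z_part D x \<mapsto>
     \<lparr>cur = i, ref_pt = c_part D x, calls = Suc (calls (the (chains s (z_part D x))))\<rparr>)\<rparr>"

definition cut_choice :: "('n::finite, 'y::finite, 'r::finite, 'u::finite, 'i::finite) two_stage
    \<Rightarrow> real ^ 'n \<Rightarrow> 'i \<Rightarrow> real ^ 'r \<Rightarrow> bool" where
  "cut_choice D x i \<pi> \<longleftrightarrow>
     is_arg_max (\<lambda>\<pi>'. cut_val D i \<pi>' x) (\<lambda>\<pi>'. \<pi>' \<in> dual_poly D) \<pi> \<and>
     \<pi> extreme_point_of dual_poly D"

text \<open>The value of \<open>r\<close> after a call; \<open>s\<close> is the state after that call.\<close>

definition risk :: "('n::finite, 'y::finite, 'r::finite, 'u::finite, 'i::finite) two_stage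
    \<Rightarrow> ('n, 'i) oracle_spec \<Rightarrow> (real ^ 'n, real ^ 'r, 'i) bc_state
    \<Rightarrow> real ^ 'n \<Rightarrow> real option \<Rightarrow> real" where
  "risk D A s x q =
     (case q of
        None \<Rightarrow>
          (let j = real (the (labels s (z_part D x)));
               k = calls (the (chains s (z_part D x)))
           in j * (j + 1) * real k * (real k + 1) / eps_false A * min 1 (delta_hat A k))
      | Some r \<Rightarrow> rho A * r)"

text \<open>
  \<open>bc_step D A s i s'\<close>: one elementary step from \<open>s\<close> to \<open>s'\<close>, where \<open>i\<close> is the scenario
  sampled by the oracle if the step is an oracle call and irrelevant otherwise.  Node selection,
  branching, bounding, the incumbents met, the initial chain states and the choice among optimal
  extreme dual points are left open.
\<close>

inductive bc_step :: "('n::finite, 'y::finite, 'r::finite, 'u::finite, 'i::finite) two_stage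
    \<Rightarrow> ('n, 'i) oracle_spec \<Rightarrow> (real ^ 'n, real ^ 'r, 'i) bc_state \<Rightarrow> 'i
    \<Rightarrow> (real ^ 'n, real ^ 'r, 'i) bc_state \<Rightarrow> bool"
  for D A where
  stay: "stopped A s \<Longrightarrow> bc_step D A s i s"
| tree: "\<lbrakk>phase s = Explore; \<not> stopped A s;
     s' = s\<lparr>created := N, opn := O', region := R, bound := B\<rparr>;
     node_replaced D v W s s'\<rbrakk>
   \<Longrightarrow> bc_step D A s i s'"
| encounter: "\<lbrakk>phase s = Explore; \<not> stopped A s;
     v \<in> opn s; master_feasible D (pool s) x \<theta>; z = z_part D x;
     s' = s\<lparr>labels := (if z \<in> dom (labels s) then labels s
                       else (labels s)(z \<mapsto> Suc (card (dom (labels s))))),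
            chains := (if z \<in> dom (chains s) then chains s
                       else (chains s)(z \<mapsto> \<lparr>cur = i0, ref_pt = c_part D x, calls = 0\<rparr>)),
            phase := Processing v x \<theta> None\<rparr>\<rbrakk>
   \<Longrightarrow> bc_step D A s i s'"
| call_cut: "\<lbrakk>phase s = Processing v x \<theta> q;
     Q D x (scen D i) > \<theta>; cut_choice D x i \<pi>;
     s' = (after_call D s x i)\<lparr>pool := insert (i, \<pi>) (pool s), bound := B, phase := Explore\<rparr>;
     bounds_valid D s'\<rbrakk>
   \<Longrightarrow> bc_step D A s i s'"
| call_certify: "\<lbrakk>phase s = Processing v x \<theta> q;
     \<not> Q D x (scen D i) > \<theta>; risk D A (after_call D s x i) x q \<le> 1;
     improving \<longleftrightarrow> ereal (obj D x + \<theta>) < upper s;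
     s' = (after_call D s x i)\<lparr>
            upper := (if improving then ereal (obj D x + \<theta>) else upper s),
            best := (if improving then Some (x, \<theta>) else best s),
            created := N, opn := O', region := R, bound := B, phase := Explore\<rparr>;
     node_replaced D v W s s'\<rbrakk>
   \<Longrightarrow> bc_step D A s i s'"
| call_again: "\<lbrakk>phase s = Processing v x \<theta> q;
     \<not> Q D x (scen D i) > \<theta>; \<not> risk D A (after_call D s x i) x q \<le> 1;
     s' = (after_call D s x i)\<lparr>phase := Processing v x \<theta> (Some (risk D A (after_call D s x i) x q))\<rparr>\<rbrakk>
   \<Longrightarrow> bc_step D A s i s'"

definition bc_run :: "('n::finite, 'y::finite, 'r::finite, 'u::finite, 'i::finite) two_stage
    \<Rightarrow> ('n, 'i) oracle_spec \<Rightarrow> (nat \<Rightarrow> (real ^ 'n, real ^ 'r, 'i) bc_state)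
    \<Rightarrow> (nat \<Rightarrow> 'i) \<Rightarrow> bool" where
  "bc_run D A S I \<longleftrightarrow> bc_init D (S 0) \<and> (\<forall>t. bc_step D A (S t) (I t) (S (Suc t)))"

text \<open>
  A random execution: \<open>S t\<close> is the algorithm state before step \<open>t\<close>, \<open>I t\<close> the scenario sampled in
  that step (if it is an oracle call), and \<open>F t\<close> the information available before step \<open>t\<close>.  All
  decisions other than the oracle samples may depend on the past in any way.  Measurability of the
  states is with respect to the discrete sigma-algebra, which is automatic when the decisions are
  functions of the finitely many samples seen so far.
\<close>

definition bc_execution :: "('n::finite, 'y::finite, 'r::finite, 'u::finite, 'i::finite) two_stage
    \<Rightarrow> ('n, 'i) oracle_spec \<Rightarrow> 'w measure \<Rightarrow> (nat \<Rightarrow> 'w measure)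
    \<Rightarrow> (nat \<Rightarrow> 'w \<Rightarrow> (real ^ 'n, real ^ 'r, 'i) bc_state) \<Rightarrow> (nat \<Rightarrow> 'w \<Rightarrow> 'i) \<Rightarrow> bool" where
  "bc_execution D A M F S I \<longleftrightarrow>
     filtration (space M) F \<and>
     (\<forall>t. subalgebra M (F t)) \<and>
     (\<forall>t. S t \<in> F t \<rightarrow>\<^sub>M count_space UNIV) \<and>
     (\<forall>t. I t \<in> F (Suc t) \<rightarrow>\<^sub>M count_space UNIV) \<and>
     (AE \<omega> in M. bc_run D A (\<lambda>t. S t \<omega>) (\<lambda>t. I t \<omega>)) \<and>
     (\<forall>t i. AE \<omega> in M. \<forall>v x \<theta> q. phase (S t \<omega>) = Processing v x \<theta> q \<longrightarrow>
        real_cond_exp M (F t) (indicator {\<omega>' \<in> space M. I t \<omega>' = i}) \<omega>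
          = pmf (call_law D A (S t \<omega>) x) i)"

end

(* The tree and the set of extreme dual points are finite, strong duality makes every returned cut
   new, and the confirmation of an incumbent ends because the risk bound shrinks by the factor
   rho < 1; hence every run stops, and its lower bound is valid because all cuts are.  So only a
   certified incumbent with theta < Q_star x can do harm.  By invariance of the Gibbs distribution a
   kernel leaves the set of argmax scenarios with probability at most the Gibbs tail, and from
   outside it stays outside with probability at most rho.  Since incumbents may be chosen depending
   on the samples, these conditional bounds are combined in a potential that starts at eps_false, is
   a supermartingale, and is at least 1 once a wrong incumbent is certified. *)

theory Submission
  imports Defs
begin

text \<open>The obstacle is adaptivity. A union bound over the calls would need
  \<open>delta_hat\<close> to bound every conditional failure probability. But the next incumbent
  may be picked after the chain is seen outside the argmax set, and from there one kernel step is
  only known to fail with probability at most rho. So a non-argmax state gets a price of its own,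
  \<open>share j k / risk_seq k\<close>: high enough to help pay for that step, low enough that one
  share covers its expected cost when the chain was not bad before. Both come from the recursion of
  \<open>risk_seq\<close>: with b, b' two successive values, b' \<ge> tail + eta * b gives rho / b'
  \<le> 1 + 1 / b. The confirmation loop has the price \<open>1 / r\<close>. As \<open>r\<close>
  starts at \<open>min 1 delta_hat / share\<close>, this price is at first at most
  \<open>share / min 1 risk_seq\<close>. Each repeat passes a wrong incumbent with probability at
  most rho while \<open>r\<close> shrinks by rho, so the price is preserved in expectation, and a
  certificate needs r \<le> 1, that is, a price of at least 1. The shares of all labels and call
  counts telescope to \<open>eps_false\<close>.\<close>

section \<open>Linear programming duality\<close>

(* A bound on the primal optimum that is not certified by a dual point would be separated from the
   closed cone generated by the constraints and by the direction that lowers the bound. *)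
lemma lp_strong_duality:
  fixes G :: "real ^ 'y::finite ^ 'r::finite" and q :: "real ^ 'r" and b :: "real ^ 'y"
  assumes feasible: "q \<le> G *v y0"
    and bound: "\<And>y. q \<le> G *v y \<Longrightarrow> v \<le> b \<bullet> y"
  obtains \<pi> where "0 \<le> \<pi>" "transpose G *v \<pi> = b" "v \<le> \<pi> \<bullet> q"
proof -
  define T :: "((real ^ 'y) \<times> real) set"
    where "T = (\<lambda>(\<pi>, t). (transpose G *v \<pi>, \<pi> \<bullet> q - t)) ` ({\<pi>. 0 \<le> \<pi>} \<times> {0..})"
  \<comment> \<open>The point is separated from \<open>C\<close>, which is closed because it has
    finitely many generators; the inclusion in \<open>T\<close> then reads off the
    multipliers.\<close>
  define C :: "((real ^ 'y) \<times> real) set"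
    where "C = convex_cone hull (insert (0, -1) (range (\<lambda>k. (row k G, q $ k))))"
  have T_I: "(transpose G *v \<pi>, \<pi> \<bullet> q - t) \<in> T" if "0 \<le> \<pi>" "0 \<le> t" for \<pi> t
    using that unfolding T_def by force
  have "C \<subseteq> T"
    unfolding C_def
  proof (rule hull_minimal)
    show "insert (0, -1) (range (\<lambda>k. (row k G, q $ k))) \<subseteq> T"
    proof (intro insert_subsetI image_subsetI)
      show "(0, -1) \<in> T"
        using T_I[of 0 1] by simp
      fix k
      have "transpose G *v axis k 1 = row k G"
        by (simp add: matrix_vector_mult_basis column_transpose)
      moreover have "axis k 1 \<bullet> q - 0 = q $ k"
        by (simp add: inner_axis')
      moreover have "(0::real ^ 'r) \<le> axis k 1"
        by (simp add: less_eq_vec_def axis_def)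
      ultimately show "(row k G, q $ k) \<in> T"
        using T_I[of "axis k 1" 0] by simp
    qed
    show "convex_cone T"
      unfolding convex_cone_iff
    proof (intro conjI ballI allI impI)
      show "0 \<in> T"
        using T_I[of 0 0] by (simp add: zero_prod_def)
    next
      fix a a' assume "a \<in> T" "a' \<in> T"
      then obtain \<pi> t \<pi>' t' where *: "0 \<le> \<pi>" "0 \<le> t" "0 \<le> \<pi>'" "0 \<le> t'"
        "a = (transpose G *v \<pi>, \<pi> \<bullet> q - t)" "a' = (transpose G *v \<pi>', \<pi>' \<bullet> q - t')"
        unfolding T_def by auto
      have "0 \<le> \<pi> + \<pi>'"
        using *(1,3) by (simp add: less_eq_vec_def)
      then show "a + a' \<in> T"
        using T_I[of "\<pi> + \<pi>'" "t + t'"] *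
        by (simp add: matrix_vector_right_distrib inner_add_left algebra_simps)
    next
      fix a and u :: real assume "a \<in> T" "0 \<le> u"
      then obtain \<pi> t where *: "0 \<le> \<pi>" "0 \<le> t" "a = (transpose G *v \<pi>, \<pi> \<bullet> q - t)"
        unfolding T_def by auto
      have "0 \<le> u *\<^sub>R \<pi>"
        using *(1) \<open>0 \<le> u\<close> by (simp add: less_eq_vec_def)
      then show "u *\<^sub>R a \<in> T"
        using T_I[of "u *\<^sub>R \<pi>" "u * t"] * \<open>0 \<le> u\<close>
        by (simp add: matrix_vector_mult_scaleR algebra_simps)
    qed
  qed
  have "(b, v) \<in> C"
  proof (rule ccontr)
    assume "(b, v) \<notin> C"
    have "convex C" "closed C"
      unfolding C_def by (simp_all add: convex_convex_cone_hull closed_convex_cone_hull)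
    then obtain a \<beta> where ab: "a \<bullet> (b, v) < \<beta>" "\<And>z. z \<in> C \<Longrightarrow> \<beta> < a \<bullet> z"
      using separating_hyperplane_closed_point[OF _ _ \<open>(b, v) \<notin> C\<close>] by blast
    have "\<beta> < 0"
      using ab(2)[of 0] by (simp add: C_def convex_cone_hull_contains_0)
    \<comment> \<open>A negative value on the cone could be scaled to equal \<open>\<beta>\<close>
      exactly, against the strict separation.\<close>
    have nonneg: "0 \<le> a \<bullet> z" if "z \<in> C" for z
    proof (rule ccontr)
      assume "\<not> 0 \<le> a \<bullet> z"
      then have "(\<beta> / (a \<bullet> z)) *\<^sub>R z \<in> C"
        using that \<open>\<beta> < 0\<close> unfolding C_def
        by (intro convex_cone_hull_mul) (simp_all add: divide_nonpos_neg)
      from ab(2)[OF this] show False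
        using \<open>\<not> 0 \<le> a \<bullet> z\<close> by simp
    qed
    obtain y \<alpha> where a: "a = (y, \<alpha>)"
      by (cases a)
    have "\<alpha> \<le> 0"
      using nonneg[of "(0, -1)"] by (simp add: C_def a hull_inc)
    have row_nonneg: "0 \<le> (G *v y) $ k + \<alpha> * q $ k" for k
      using nonneg[of "(row k G, q $ k)"]
      by (simp add: C_def a hull_inc matrix_vector_mul_component row_def vec_lambda_eta inner_commute)
    have lt: "y \<bullet> b + \<alpha> * v < 0"
      using ab(1) \<open>\<beta> < 0\<close> by (simp add: a)
    show False
    proof (cases "\<alpha> = 0")
      case True
      \<comment> \<open>Here \<open>y\<close> is a recession direction of negative cost. This length
        lowers the cost of \<open>y0\<close> by \<open>\<bar>b \<bullet> y0 - v\<bar> + 1\<close>,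
        hence below \<open>v\<close>.\<close>
      define s where "s = (\<bar>b \<bullet> y0 - v\<bar> + 1) / (- (b \<bullet> y))"
      have neg: "b \<bullet> y < 0"
        using lt True by (simp add: inner_commute)
      then have "0 \<le> s"
        unfolding s_def by (intro divide_nonneg_pos) auto
      have "q $ k \<le> (G *v (y0 + s *\<^sub>R y)) $ k" for k
        using feasible row_nonneg[of k] True \<open>0 \<le> s\<close>
        by (simp add: matrix_vector_right_distrib matrix_vector_mult_scaleR less_eq_vec_def add_increasing2)
      then have "v \<le> b \<bullet> (y0 + s *\<^sub>R y)"
        by (intro bound) (simp add: less_eq_vec_def)
      also have "\<dots> = b \<bullet> y0 - (\<bar>b \<bullet> y0 - v\<bar> + 1)"
        using neg by (simp add: s_def inner_diff_right)
      finally show False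
        by linarith
    next
      case False
      then have "\<alpha> < 0"
        using \<open>\<alpha> \<le> 0\<close> by simp
      \<comment> \<open>Scaling the last coordinate of the functional to -1 makes
        \<open>s *\<^sub>R y\<close> a feasible point of cost below \<open>v\<close>.\<close>
      define s where "s = inverse (- \<alpha>)"
      have s: "0 < s" "s * \<alpha> = - 1"
        using \<open>\<alpha> < 0\<close> by (simp_all add: s_def)
      have "0 \<le> s * ((G *v y) $ k + \<alpha> * q $ k)" for k
        using row_nonneg[of k] s(1) by simp
      then have "q $ k \<le> (G *v (s *\<^sub>R y)) $ k" for k
        using s(2) by (simp add: matrix_vector_mult_scaleR distrib_left flip: mult.assoc)
      then have "v \<le> b \<bullet> (s *\<^sub>R y)"
        by (intro bound) (simp add: less_eq_vec_def)
      moreover have "s * (y \<bullet> b + \<alpha> * v) < 0"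
        using lt s(1) by (simp add: mult_pos_neg)
      ultimately show False
        using s(2) by (simp add: distrib_left inner_commute flip: mult.assoc)
    qed
  qed
  with \<open>C \<subseteq> T\<close> obtain \<pi> t where "0 \<le> \<pi>" "0 \<le> t" "transpose G *v \<pi> = b" "\<pi> \<bullet> q - t = v"
    unfolding T_def by auto
  then show thesis
    by (intro that[of \<pi>]) auto
qed

section \<open>Duality for the recourse program: validity, tightness and finiteness of the
  cuts\<close>

lemma recourse_set_iff:
  "y \<in> recourse_set D x \<xi> \<longleftrightarrow> h_vec D - E_mat D *v x - U_mat D *v \<xi> \<le> G_mat D *v y"
  unfolding recourse_set_def less_eq_vec_def by (auto simp: algebra_simps)

lemma cut_val_le_Q:
  assumes "\<pi> \<in> dual_poly D" "Q_finite D x (scen D i)"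
  shows "cut_val D i \<pi> x \<le> Q D x (scen D i)"
  unfolding Q_def
proof (rule cINF_greatest)
  show "recourse_set D x (scen D i) \<noteq> {}"
    using assms(2) by (simp add: Q_finite_def)
  fix y assume "y \<in> recourse_set D x (scen D i)"
  then have le: "h_vec D - E_mat D *v x - U_mat D *v scen D i \<le> G_mat D *v y"
    by (simp add: recourse_set_iff)
  have "\<pi> \<bullet> (h_vec D - E_mat D *v x - U_mat D *v scen D i) \<le> \<pi> \<bullet> (G_mat D *v y)"
    using assms(1) le unfolding inner_vec_def dual_poly_def less_eq_vec_def
    by (intro sum_mono) (auto intro: mult_left_mono)
  also have "\<dots> = b_vec D \<bullet> y"
    using assms(1) by (auto simp: dual_poly_def simp flip: dot_lmul_matrix)
  finally show "cut_val D i \<pi> x \<le> b_vec D \<bullet> y"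
    by (simp add: cut_val_def)
qed

text \<open>Strong duality provides a dual point that reaches the recourse value, and the chosen
  multiplier does at least as well. This tightness at the incumbent is what makes a violated cut
  new.\<close>

lemma Q_le_cut_choice:
  assumes "cut_choice D x i \<pi>" "Q_finite D x (scen D i)"
  shows "Q D x (scen D i) \<le> cut_val D i \<pi> x"
proof -
  let ?R = "recourse_set D x (scen D i)"
  let ?q = "h_vec D - E_mat D *v x - U_mat D *v scen D i"
  obtain y0 where feasible: "?q \<le> G_mat D *v y0"
    using assms(2) by (auto simp: Q_finite_def recourse_set_iff)
  have bound: "Q D x (scen D i) \<le> b_vec D \<bullet> y" if "?q \<le> G_mat D *v y" for y
    using that assms(2) unfolding Q_def
    by (intro cINF_lower) (simp_all add: Q_finite_def recourse_set_iff)
  obtain \<pi>' where "0 \<le> \<pi>'" "transpose (G_mat D) *v \<pi>' = b_vec D" "Q D x (scen D i) \<le> \<pi>' \<bullet> ?q"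
    using lp_strong_duality[OF feasible bound] .
  then have "\<pi>' \<in> dual_poly D" "Q D x (scen D i) \<le> cut_val D i \<pi>' x"
    unfolding dual_poly_def cut_val_def by blast+
  then show ?thesis
    using assms(1) by (fastforce simp: cut_choice_def is_arg_max_linorder)
qed

text \<open>Each equality constraint is a pair of halfspaces, so the dual set is a polyhedron.
  Together with the finite scenario set this limits the cuts that the oracle can ever
  return.\<close>

lemma finite_extreme_dual: "finite {\<pi>. \<pi> extreme_point_of dual_poly D}"
proof (rule finite_polyhedron_extreme_points)
  have "dual_poly D = (\<Inter>k. {\<pi>. axis k 1 \<bullet> \<pi> \<ge> 0}) \<inter>
      (\<Inter>k. {\<pi>. row k (transpose (G_mat D)) \<bullet> \<pi> \<le> b_vec D $ k} \<inter>
           {\<pi>. row k (transpose (G_mat D)) \<bullet> \<pi> \<ge> b_vec D $ k})"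
    by (auto simp: dual_poly_def less_eq_vec_def inner_axis' vec_eq_iff matrix_vector_mul_component
        row_def vec_lambda_eta order_eq_iff simp del: transpose_matrix_vector)
  also have "polyhedron \<dots>"
    by (auto intro!: polyhedron_Int polyhedron_Inter polyhedron_halfspace_le polyhedron_halfspace_ge)
  finally show "polyhedron (dual_poly D)" .
qed

section \<open>The recourse function\<close>

lemma Q_le_Q_star: "Q D x (scen D i) \<le> Q_star D x"
  unfolding Q_star_def by (intro Max_ge) auto

lemma I_star_iff: "i \<in> I_star D x \<longleftrightarrow> Q D x (scen D i) = Q_star D x"
proof
  assume "i \<in> I_star D x"
  then have "Q D x (scen D j) \<le> Q D x (scen D i)" for j
    by (simp add: I_star_def is_arg_max_linorder)
  then have "Q_star D x \<le> Q D x (scen D i)"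
    unfolding Q_star_def by (intro Max.boundedI) auto
  then show "Q D x (scen D i) = Q_star D x"
    using Q_le_Q_star[of D x i] by simp
next
  assume "Q D x (scen D i) = Q_star D x"
  then show "i \<in> I_star D x"
    using Q_le_Q_star[of D x] by (simp add: I_star_def is_arg_max_linorder)
qed

lemma I_star_nonempty: "\<exists>i. i \<in> I_star D x"
proof -
  have "Q_star D x \<in> range (\<lambda>i. Q D x (scen D i))"
    unfolding Q_star_def by (intro Max_in) auto
  then show ?thesis
    by (auto simp: I_star_iff)
qed

text \<open>Hence the key of a chain plus its reference point is the incumbent of its last call;
  invariants can speak of that incumbent although only its continuous part is stored.\<close>

lemma z_part_plus_c_part: "z_part D x + c_part D x = x"
  by (simp add: z_part_def c_part_def vec_eq_iff)

section \<open>Escape probabilities of the kernels\<close>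

lemma tv_dist_ge: "measure_pmf.prob \<mu> B - measure_pmf.prob \<nu> B \<le> tv_dist \<mu> \<nu>"
proof -
  have "\<bar>measure_pmf.prob \<mu> B - measure_pmf.prob \<nu> B\<bar> \<le> tv_dist \<mu> \<nu>"
    unfolding tv_dist_def
  proof (rule cSUP_upper)
    show "bdd_above (range (\<lambda>B. \<bar>measure_pmf.prob \<mu> B - measure_pmf.prob \<nu> B\<bar>))"
      by (rule bdd_aboveI[of _ 1]) (auto simp: abs_le_iff intro!: diff_le_eq[THEN iffD2] add_increasing2)
  qed simp
  then show ?thesis
    by linarith
qed

lemma prob_eq_sum_pmf: "measure_pmf.prob p B = (\<Sum>i\<in>B. pmf p i)" for p :: "'a::finite pmf"
  by (simp add: measure_measure_pmf_finite)

lemma prob_bind_pmf: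
  "measure_pmf.prob (bind_pmf p K) B = (\<Sum>j\<in>UNIV. pmf p j * measure_pmf.prob (K j) B)"
  for p :: "'a::finite pmf" and K :: "'a \<Rightarrow> 'a pmf"
  by (simp add: prob_eq_sum_pmf pmf_bind integral_measure_pmf_real[of UNIV] sum_distrib_left mult.commute)
     (rule sum.swap)

lemma divide_powr_minus: "(x / c) powr (- a) = c powr a * x powr (- a)" for x c a :: real
  unfolding powr_minus powr_divide by (simp add: divide_inverse)

lemma sum_pmf_UNIV: "(\<Sum>j\<in>UNIV. pmf p j) = 1" for p :: "'a::finite pmf"
  by (simp add: sum_pmf_eq_1)

locale separation_oracle =
  fixes D :: "('n::finite, 'y::finite, 'r::finite, 'u::finite, 'i::finite) two_stage"
    and A :: "('n, 'i) oracle_spec"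
  assumes scenarios: "CARD('i) \<ge> 2"
    and score_accuracy: "x \<in> feas D \<Longrightarrow> \<bar>score A x i - Q D x (scen D i)\<bar> \<le> eps A"
    and score_lipschitz: "x \<in> feas D \<Longrightarrow> x' \<in> feas D \<Longrightarrow>
          \<bar>score A x i - score A x' i\<bar> \<le> L_Q A * norm (x - x')"
    and L_Q_pos: "L_Q A > 0"
    and kernel_invariance: "x \<in> feas D \<Longrightarrow> kernel_invariant (kern A x) (softmax A x)"
    and kernel_contraction: "x \<in> feas D \<Longrightarrow>
          (SUP (i, j). tv_dist (kern A x i) (kern A x j)) \<le> eta A"
    and eta_pos: "0 < eta A" and eta_lt_1: "eta A < 1"
    and Delta_gt: "Delta A > 4 * eps A"
    and temp_pos: "0 < temp A"
    and temp_le: "temp A \<le> (Delta A - 2 * eps A) / ln (2 * (real CARD('i) - 1) / (1 - eta A))"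
    and decay_pos: "decay A > 0"
    and c0_pos: "c0 A > 0"
    and eps_false_pos: "0 < eps_false A"
begin

definition gap :: "real ^ 'n \<Rightarrow> bool" where
  "gap x \<longleftrightarrow> x \<in> feas D \<and> (\<forall>j. j \<notin> I_star D x \<longrightarrow> Q_star D x - Q D x (scen D j) \<ge> Delta A)"

text \<open>Allowance for the change of incumbent after \<open>k\<close> calls. It is sized to cover
  both step lengths of the oracle: see \<open>near_drift\<close> and
  \<open>far_drift\<close>.\<close>

definition drift :: "nat \<Rightarrow> real" where
  "drift k = drift_const A * real k powr (- decay A)"

lemma drift_const_pos: "0 < drift_const A"
  unfolding drift_const_def using c0_pos eta_pos L_Q_pos Delta_gt by (simp)

lemma drift_nonneg: "0 \<le> drift k"
  unfolding drift_def using drift_const_pos by simp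

lemma gibbs_tail_pos: "0 < gibbs_tail A"
  unfolding gibbs_tail_def using scenarios by simp

text \<open>This is the temperature condition solved for the exponential; it yields rho \<le> (1 +
  eta) / 2 < 1.\<close>

lemma gibbs_tail_le: "gibbs_tail A \<le> (1 - eta A) / 2"
proof -
  define m where "m = real CARD('i) - 1"
  define a where "a = 2 * m / (1 - eta A)"
  have m: "1 \<le> m"
    using scenarios by (simp add: m_def)
  then have a: "1 < a"
    using eta_pos eta_lt_1 by (simp add: a_def less_divide_eq)
  then have "ln a \<le> (Delta A - 2 * eps A) / temp A"
    using temp_le temp_pos ln_gt_zero[OF a] by (simp add: a_def m_def field_simps)
  then have "exp (- (Delta A - 2 * eps A) / temp A) \<le> exp (- ln a)"
    by (simp only: exp_le_cancel_iff minus_divide_left[symmetric] neg_le_iff_le)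
  also have "\<dots> = 1 / a"
    using a by (simp add: exp_minus inverse_eq_divide)
  finally have "gibbs_tail A \<le> m * (1 / a)"
    unfolding gibbs_tail_def m_def[symmetric] using m by (intro mult_left_mono) auto
  also have "\<dots> = (1 - eta A) / 2"
    using m by (simp add: a_def)
  finally show ?thesis .
qed

lemma rho_pos: "0 < rho A" and rho_lt_1: "rho A < 1"
  using gibbs_tail_pos gibbs_tail_le eta_pos eta_lt_1 by (simp_all add: rho_def)

text \<open>Fixed point of \<open>u \<mapsto> gibbs_tail A + eta A * u\<close>, the recursion that
  one kernel step imposes on the probability of lying outside the argmax set.\<close>

definition limit_risk :: real where
  "limit_risk = gibbs_tail A / (1 - eta A)"

lemma limit_risk_pos: "0 < limit_risk"
  using gibbs_tail_pos eta_lt_1 by (simp add: limit_risk_def)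

lemma limit_risk_fixed: "gibbs_tail A + eta A * limit_risk = limit_risk"
  using eta_lt_1 by (simp add: limit_risk_def field_simps)

lemma escape_diff:
  assumes "x \<in> feas D"
  shows "measure_pmf.prob (kern A x i) B - measure_pmf.prob (kern A x j) B \<le> eta A"
proof -
  have "measure_pmf.prob (kern A x i) B - measure_pmf.prob (kern A x j) B
      \<le> (case (i, j) of (i, j) \<Rightarrow> tv_dist (kern A x i) (kern A x j))"
    by (simp add: tv_dist_ge)
  also have "\<dots> \<le> (SUP (i, j). tv_dist (kern A x i) (kern A x j))"
    by (rule cSUP_upper) simp_all
  also have "\<dots> \<le> eta A"
    by (rule kernel_contraction[OF assms])
  finally show ?thesis .
qed

(* Every argmax scenario is at least exp ((Delta - 2 eps) / w) times as likely as every other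
   scenario, so the stationary flow into the complement of the argmax set already bounds the escape
   probability of each single argmax state, also when there are ties. *)
lemma escape_from_argmax:
  assumes "gap x" "i \<in> I_star D x"
  shows "measure_pmf.prob (kern A x i) (- I_star D x) \<le> gibbs_tail A"
proof -
  let ?B = "- I_star D x" and ?q = "softmax A x"
  define e where "e = exp (- (Delta A - 2 * eps A) / temp A)"
  have x: "x \<in> feas D"
    using assms(1) by (simp add: gap_def)
  have Z: "0 < (\<Sum>j\<in>UNIV. exp (score A x j / temp A))"
    by (intro sum_pos) auto
  have q_pos: "0 < ?q j" for j
    using Z by (simp add: softmax_def)
  have ratio: "?q l \<le> ?q i * e" if "l \<in> ?B" for l
  proof -
    have "Q D x (scen D i) - Q D x (scen D l) \<ge> Delta A"
      using assms that by (simp add: gap_def I_star_iff)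
    then have "score A x l \<le> score A x i - (Delta A - 2 * eps A)"
      using score_accuracy[OF x, of i] score_accuracy[OF x, of l] by linarith
    then have "score A x l / temp A \<le> score A x i / temp A + - (Delta A - 2 * eps A) / temp A"
      using temp_pos by (simp add: field_simps)
    then have "exp (score A x l / temp A) \<le> exp (score A x i / temp A) * e"
      by (simp add: e_def flip: exp_add)
    then show ?thesis
      using Z by (simp add: softmax_def divide_right_mono)
  qed
  have "?q i * measure_pmf.prob (kern A x i) ?B \<le> (\<Sum>j\<in>UNIV. ?q j * measure_pmf.prob (kern A x j) ?B)"
    by (rule member_le_sum) (auto intro: mult_nonneg_nonneg less_imp_le[OF q_pos])
  also have "\<dots> = (\<Sum>l\<in>?B. \<Sum>j\<in>UNIV. ?q j * pmf (kern A x j) l)"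
    by (simp add: prob_eq_sum_pmf sum_distrib_left) (rule sum.swap)
  also have "\<dots> = (\<Sum>l\<in>?B. ?q l)"
    using kernel_invariance[OF x] by (simp add: kernel_invariant_def)
  also have "\<dots> \<le> (\<Sum>l\<in>?B. ?q i * e)"
    by (intro sum_mono ratio)
  also have "\<dots> = real (card ?B) * (?q i * e)"
    by simp
  also have "\<dots> \<le> (real CARD('i) - 1) * (?q i * e)"
  proof (rule mult_right_mono)
    have "card ?B \<le> card (UNIV - {i})"
      using assms(2) by (intro card_mono) auto
    then show "real (card ?B) \<le> real CARD('i) - 1"
      using scenarios by (simp add: card_Diff_singleton)
    show "0 \<le> ?q i * e"
      using q_pos[of i] by (simp add: e_def)
  qed
  also have "\<dots> = ?q i * gibbs_tail A"
    by (simp add: gibbs_tail_def e_def)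
  finally show ?thesis
    using q_pos[of i] by simp
qed

text \<open>The row of a non-argmax state is within eta, in total variation, of the row of some
  argmax state, whose escape probability is at most the Gibbs tail.\<close>

lemma escape_step:
  assumes "gap x"
  shows "measure_pmf.prob (kern A x i) (- I_star D x)
    \<le> gibbs_tail A + eta A * indicator (- I_star D x) i"
proof (cases "i \<in> I_star D x")
  case True
  then show ?thesis
    using escape_from_argmax[OF assms True] by simp
next
  case False
  obtain j where "j \<in> I_star D x"
    using I_star_nonempty by blast
  then show ?thesis
    using escape_from_argmax[OF assms] escape_diff[of x i "- I_star D x" j] False assms
    by (fastforce simp: gap_def)
qed

lemma escape_step_rho: "gap x \<Longrightarrow> measure_pmf.prob (kern A x i) (- I_star D x) \<le> rho A"
  using escape_step[of x i] eta_pos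
  by (cases "i \<in> I_star D x") (auto simp: rho_def)

text \<open>Averaging \<open>escape_step\<close> over the state reached after \<open>m\<close> steps
  gives an affine recursion; the distance from its fixed point shrinks by eta per step and is
  present only for a start outside the argmax set.\<close>

lemma escape_pow:
  assumes "gap x"
  shows "measure_pmf.prob (kernel_pow (kern A x) m i) (- I_star D x)
    \<le> limit_risk + eta A ^ m * indicator (- I_star D x) i"
proof (induction m)
  case 0
  show ?case
    using limit_risk_pos by (simp add: indicator_def)
next
  case (Suc m)
  let ?p = "kernel_pow (kern A x) m i" and ?B = "- I_star D x"
  have "measure_pmf.prob (kernel_pow (kern A x) (Suc m) i) ?B
      = (\<Sum>j\<in>UNIV. pmf ?p j * measure_pmf.prob (kern A x j) ?B)"
    by (simp add: prob_bind_pmf)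
  also have "\<dots> \<le> (\<Sum>j\<in>UNIV. pmf ?p j * (gibbs_tail A + eta A * indicator ?B j))"
    by (intro sum_mono mult_left_mono escape_step assms) simp
  also have "\<dots> = gibbs_tail A + eta A * measure_pmf.prob ?p ?B"
  proof -
    have "(\<Sum>j\<in>UNIV. pmf ?p j * indicator ?B j) = measure_pmf.prob ?p ?B"
      unfolding prob_eq_sum_pmf by (rule sum.mono_neutral_cong_right) (auto simp: indicator_def)
    moreover have "(\<Sum>j\<in>UNIV. pmf ?p j * (gibbs_tail A + eta A * indicator ?B j))
        = gibbs_tail A * (\<Sum>j\<in>UNIV. pmf ?p j) + eta A * (\<Sum>j\<in>UNIV. pmf ?p j * indicator ?B j)"
      unfolding sum_distrib_left sum.distrib[symmetric] by (intro sum.cong) (auto simp: algebra_simps)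
    ultimately show ?thesis
      by (simp add: sum_pmf_UNIV)
  qed
  also have "\<dots> \<le> gibbs_tail A + eta A * (limit_risk + eta A ^ m * indicator ?B i)"
    using Suc.IH eta_pos by (intro add_left_mono mult_left_mono) auto
  also have "\<dots> = limit_risk + eta A ^ Suc m * indicator ?B i"
    using limit_risk_fixed by (simp add: algebra_simps)
  finally show ?case .
qed

text \<open>Some scenario \<open>j\<close> does not beat \<open>i\<close> at \<open>x\<close> but
  beats it by Delta at \<open>x'\<close>. Passing from values to scores costs four errors of size
  eps, and two scores have to move.\<close>

lemma I_star_stable:
  assumes "gap x" "gap x'" "i \<in> I_star D x" "i \<notin> I_star D x'"
  shows "Delta A - 4 * eps A \<le> 2 * L_Q A * norm (x - x')"
proof -
  obtain j where j: "j \<in> I_star D x'"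
    using I_star_nonempty by blast
  have x: "x \<in> feas D" "x' \<in> feas D"
    using assms by (simp_all add: gap_def)
  have "Q D x (scen D j) \<le> Q D x (scen D i)"
    using assms(3) Q_le_Q_star[of D x j] by (simp add: I_star_iff)
  moreover have "Delta A \<le> Q D x' (scen D j) - Q D x' (scen D i)"
    using assms j by (simp add: gap_def I_star_iff)
  ultimately show ?thesis
    using score_accuracy[OF x(1), of i] score_accuracy[OF x(1), of j]
      score_accuracy[OF x(2), of i] score_accuracy[OF x(2), of j]
      score_lipschitz[OF x, of i] score_lipschitz[OF x, of j]
    by linarith
qed

text \<open>A close pair of incumbents can disagree about \<open>i\<close> only while the distance
  threshold is still large. \<open>drift_const\<close> is chosen so that the drift is then at least
  eta, the extra escape probability of a state outside the argmax set.\<close>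

lemma near_drift:
  assumes "gap x" "gap x'" "i \<in> I_star D x" "i \<notin> I_star D x'"
    and "norm (x' - x) \<le> c0 A * real k powr (- decay A)"
  shows "eta A \<le> drift k"
proof -
  have "Delta A - 4 * eps A \<le> 2 * L_Q A * norm (x' - x)"
    using I_star_stable[OF assms(1-4)] by (simp add: norm_minus_commute)
  also have "\<dots> \<le> 2 * L_Q A * (c0 A * real k powr (- decay A))"
    using assms(5) L_Q_pos by simp
  finally have "eta A * (Delta A - 4 * eps A) \<le> eta A * (2 * L_Q A * (c0 A * real k powr (- decay A)))"
    using eta_pos by simp
  then show ?thesis
    using Delta_gt by (simp add: drift_def drift_const_def field_simps)
qed

text \<open>\<open>g\<close> comes from solving eta ^ m \<le> drift k for \<open>m\<close> by
  logarithms and rounding up, with at least one step.\<close>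

lemma far_drift:
  assumes "1 \<le> k"
  shows "eta A ^ g A k \<le> drift k"
proof -
  define t where "t = (decay A * ln (real k) - ln (drift_const A)) / \<bar>ln (eta A)\<bar>"
  have ln_eta: "ln (eta A) < 0"
    using eta_pos eta_lt_1 by simp
  have "t \<le> real (g A k)"
    using assms unfolding g_def t_def by (simp add: max_def)
  then have "real (g A k) * ln (eta A) \<le> t * ln (eta A)"
    using ln_eta by simp
  also have "\<dots> = ln (drift_const A) - decay A * ln (real k)"
    using ln_eta by (simp add: t_def)
  also have "\<dots> = ln (drift k)"
    using assms drift_const_pos by (simp add: drift_def ln_mult ln_powr)
  finally have "ln (eta A ^ g A k) \<le> ln (drift k)"
    using eta_pos by (simp add: ln_realpow)
  moreover have "0 < drift k"
    using assms drift_const_pos by (simp add: drift_def)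
  ultimately show ?thesis
    using eta_pos by simp
qed

section \<open>The risk bound\<close>

(* The recursion behind delta_hat: one more call contracts the risk by eta and adds the Gibbs tail
   and the drift.  The value at 0 makes risk_seq 1 = limit_risk + 1, since drift 0 = 0. *)
primrec risk_seq :: "nat \<Rightarrow> real" where
  "risk_seq 0 = limit_risk + 1 / eta A"
| "risk_seq (Suc k) = gibbs_tail A + eta A * risk_seq k + drift k"

lemma risk_seq_ge_limit: "limit_risk \<le> risk_seq k"
proof (induction k)
  case (Suc k)
  have "limit_risk = gibbs_tail A + eta A * limit_risk"
    using limit_risk_fixed by simp
  also have "\<dots> \<le> gibbs_tail A + eta A * risk_seq k"
    using Suc eta_pos by simp
  finally show ?case
    using drift_nonneg[of k] by simp
qed (use eta_pos in simp)

lemma risk_seq_pos: "0 < risk_seq k"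
  using risk_seq_ge_limit[of k] limit_risk_pos by linarith

lemma risk_seq_Suc_ge: "limit_risk + drift k \<le> risk_seq (Suc k)"
proof -
  have "gibbs_tail A + eta A * limit_risk \<le> gibbs_tail A + eta A * risk_seq k"
    using risk_seq_ge_limit[of k] eta_pos by simp
  then show ?thesis
    using limit_risk_fixed by simp
qed

text \<open>Nothing is known about the initial state of a chain, so the bound for the first call has
  to exceed 1.\<close>

lemma risk_seq_1: "risk_seq 1 = limit_risk + 1"
  using limit_risk_fixed eta_pos decay_pos by (simp add: drift_def algebra_simps)

text \<open>Unrolled, the drift after \<open>s\<close> calls is damped by eta at every later call;
  this leaves a convolution of geometric and polynomial decay.\<close>

lemma risk_seq_eq:
  "risk_seq (Suc k) = limit_risk + eta A ^ k + (\<Sum>s=1..k. eta A ^ (k - s) * drift s)"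
proof (induction k)
  case 0
  then show ?case
    using risk_seq_1 by simp
next
  case (Suc k)
  have "eta A * (\<Sum>s=1..k. eta A ^ (k - s) * drift s) = (\<Sum>s=1..k. eta A ^ (Suc k - s) * drift s)"
    unfolding sum_distrib_left by (intro sum.cong) (auto simp: Suc_diff_le)
  then show ?case
    unfolding risk_seq.simps(2)[of "Suc k"] Suc.IH
    using limit_risk_fixed by (simp add: algebra_simps)
qed

section \<open>Convolution of geometric damping with polynomial drift: the origin of
  \<open>C_const\<close>\<close>

lemma sum_eta_le:
  assumes "finite J" "\<And>s. s \<in> J \<Longrightarrow> s \<le> (k::nat)" "\<And>s. s \<in> J \<Longrightarrow> a \<le> k - s"
  shows "(\<Sum>s\<in>J. eta A ^ (k - s)) \<le> eta A ^ a / (1 - eta A)"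
proof -
  have "(\<Sum>s\<in>J. eta A ^ (k - s)) = (\<Sum>l\<in>(\<lambda>s. k - s) ` J. eta A ^ l)"
    by (subst sum.reindex) (auto simp: inj_on_def dest!: assms(2))
  also have "\<dots> \<le> (\<Sum>l=a..a + k. eta A ^ l)"
    using assms eta_pos by (intro sum_mono2) auto
  also have "\<dots> \<le> eta A ^ a / (1 - eta A)"
    using eta_pos eta_lt_1 by (simp add: sum_gp divide_right_mono)
  finally show ?thesis .
qed

text \<open>The function t ^ p * eta ^ (t / 2) is largest at t = 2 * p / \<bar>ln eta\<bar>, where
  it equals the constant on the right. In the proof \<open>z\<close> is \<open>t\<close> divided by
  this maximizer, and the maximum is the inequality ln z \<le> z - 1.\<close>

lemma exp_decay_le_powr:
  assumes "0 < t"
  shows "eta A powr (t / 2) \<le> (2 * decay A / (exp 1 * \<bar>ln (eta A)\<bar>)) powr decay A * t powr (- decay A)"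
proof -
  define a where "a = \<bar>ln (eta A)\<bar>"
  have a: "0 < a" "ln (eta A) = - a"
    using eta_pos eta_lt_1 by (simp_all add: a_def)
  define z where "z = a * t / (2 * decay A)"
  have z: "0 < z"
    using a assms decay_pos by (simp add: z_def)
  have "ln z \<le> z - 1"
    by (rule ln_le_minus_one[OF z])
  then have "decay A * (ln z + 1) \<le> decay A * z"
    using decay_pos by simp
  also have "\<dots> = a * t / 2"
    using decay_pos by (simp add: z_def)
  finally have *: "- (a * t / 2) \<le> - decay A * (ln z + 1)"
    by simp
  have "eta A powr (t / 2) = exp (- (a * t / 2))"
    using eta_pos a by (simp add: powr_def)
  also have "\<dots> \<le> exp (- decay A * (ln z + 1))"
    using * by simp
  also have "\<dots> = (z * exp 1) powr (- decay A)"
    using z by (simp add: powr_def ln_mult)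
  also have "z * exp 1 = t / (2 * decay A / (exp 1 * a))"
    using decay_pos a by (simp add: z_def)
  also have "(t / (2 * decay A / (exp 1 * a))) powr (- decay A)
      = (2 * decay A / (exp 1 * a)) powr decay A * t powr (- decay A)"
    by (rule divide_powr_minus)
  finally show ?thesis
    by (simp add: a_def)
qed

(* Terms with s at least half of k + 1 are bounded through powr, the others through the geometric
   factor; the two parts give the two summands of C_const. *)
lemma convolution_le:
  "(\<Sum>s=1..k. eta A ^ (k - s) * real s powr (- decay A)) \<le> C_const A * real (Suc k) powr (- decay A)"
proof -
  let ?K = "real (Suc k)"
  define H where "H = {s\<in>{1..k}. ?K \<le> 2 * real s}"
  define L where "L = {s\<in>{1..k}. 2 * real s < ?K}"
  let ?f = "\<lambda>s. eta A ^ (k - s) * real s powr (- decay A)"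
  have split: "{1..k} = H \<union> L" "H \<inter> L = {}" "finite H" "finite L"
    by (auto simp: H_def L_def)
  have "(\<Sum>s\<in>H. ?f s) \<le> (\<Sum>s\<in>H. eta A ^ (k - s) * (2 powr decay A * ?K powr (- decay A)))"
  proof (intro sum_mono mult_left_mono)
    fix s assume s: "s \<in> H"
    then have "real s powr (- decay A) \<le> (?K / 2) powr (- decay A)"
      using decay_pos by (intro powr_mono2') (auto simp: H_def)
    also have "\<dots> = 2 powr decay A * ?K powr (- decay A)"
      by (rule divide_powr_minus)
    finally show "real s powr (- decay A) \<le> 2 powr decay A * ?K powr (- decay A)" .
  qed (use eta_pos in simp)
  also have "\<dots> = (\<Sum>s\<in>H. eta A ^ (k - s)) * (2 powr decay A * ?K powr (- decay A))"
    by (simp add: sum_distrib_right)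
  also have "\<dots> \<le> 1 / (1 - eta A) * (2 powr decay A * ?K powr (- decay A))"
  proof (rule mult_right_mono)
    have "s \<le> k" if "s \<in> H" for s
      using that by (simp add: H_def)
    from sum_eta_le[OF split(3) this, of 0] show "(\<Sum>s\<in>H. eta A ^ (k - s)) \<le> 1 / (1 - eta A)"
      by simp
  qed simp
  finally have high: "(\<Sum>s\<in>H. ?f s) \<le> 1 / (1 - eta A) * (2 powr decay A * ?K powr (- decay A))" .
  have "(\<Sum>s\<in>L. ?f s) \<le> (\<Sum>s\<in>L. eta A ^ (k - s))"
  proof (intro sum_mono)
    fix s assume "s \<in> L"
    then have "real s powr (- decay A) \<le> 1 powr (- decay A)"
      using decay_pos by (intro powr_mono2') (auto simp: L_def)
    then show "?f s \<le> eta A ^ (k - s)"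
      using eta_pos mult_left_mono[of "real s powr (- decay A)" 1 "eta A ^ (k - s)"] by simp
  qed
  also have "\<dots> \<le> eta A ^ (k - k div 2) / (1 - eta A)"
    by (rule sum_eta_le) (auto simp: L_def)
  also have "\<dots> \<le> eta A powr ((real k) / 2) / (1 - eta A)"
  proof (rule divide_right_mono)
    have "eta A ^ (k - k div 2) = eta A powr real (k - k div 2)"
      using powr_realpow[OF eta_pos, of "k - k div 2"] by (rule sym)
    also have "\<dots> \<le> eta A powr (real k / 2)"
    proof (rule powr_mono')
      have "k \<le> 2 * (k - k div 2)"
        by linarith
      then show "real k / 2 \<le> real (k - k div 2)"
        by linarith
    qed (use eta_pos eta_lt_1 in auto)
    finally show "eta A ^ (k - k div 2) \<le> eta A powr (real k / 2)" .
  qed (use eta_lt_1 in simp)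
  \<comment> \<open>The exponent reaches half of \<open>k\<close>, while the bound is wanted at
    \<open>Suc k\<close>; the missing one half is the factor \<open>eta A powr (- 1 / 2)\<close> in
    \<open>C_const\<close>.\<close>
  also have "eta A powr (real k / 2) = eta A powr (- 1 / 2) * eta A powr (?K / 2)"
    by (simp add: flip: powr_add) (simp add: field_simps)
  also have "\<dots> / (1 - eta A) \<le> eta A powr (- 1 / 2) *
      ((2 * decay A / (exp 1 * \<bar>ln (eta A)\<bar>)) powr decay A * ?K powr (- decay A)) / (1 - eta A)"
    using exp_decay_le_powr[of ?K] eta_lt_1 by (intro divide_right_mono mult_left_mono) auto
  finally have low: "(\<Sum>s\<in>L. ?f s) \<le> eta A powr (- 1 / 2) *
      ((2 * decay A / (exp 1 * \<bar>ln (eta A)\<bar>)) powr decay A * ?K powr (- decay A)) / (1 - eta A)" .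
  have "(\<Sum>s=1..k. ?f s) = (\<Sum>s\<in>H. ?f s) + (\<Sum>s\<in>L. ?f s)"
    unfolding split(1) by (rule sum.union_disjoint[OF split(3,4,2)])
  also have "\<dots> \<le> C_const A * ?K powr (- decay A)"
  proof -
    have "1 / c * (u * w) + y * (z * w) / c = 1 / c * (u + y * z) * w" for c u w y z :: real
      by (simp add: algebra_simps add_divide_distrib)
    then show ?thesis
      using add_mono[OF high low] unfolding C_const_def by (simp only:)
  qed
  finally show ?thesis .
qed

text \<open>The algorithm uses the closed form, whereas the potential needs the recursion of
  \<open>risk_seq\<close>; this inequality is the link between them.\<close>

lemma risk_seq_le_delta_hat:
  assumes "1 \<le> k"
  shows "risk_seq k \<le> delta_hat A k"
proof -
  obtain l where k: "k = Suc l"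
    using assms by (cases k) auto
  have "(\<Sum>s=1..l. eta A ^ (l - s) * drift s)
      = drift_const A * (\<Sum>s=1..l. eta A ^ (l - s) * real s powr (- decay A))"
    by (simp add: drift_def sum_distrib_left mult_ac)
  also have "\<dots> \<le> drift_const A * (C_const A * real (Suc l) powr (- decay A))"
    using convolution_le drift_const_pos by (intro mult_left_mono) auto
  finally show ?thesis
    unfolding k risk_seq_eq by (simp add: delta_hat_def limit_risk_def mult_ac)
qed

end

section \<open>Runs of the algorithm\<close>

context separation_oracle
begin

text \<open>A called chain refers to an incumbent with score gap, which the risk analysis compares
  with the next one. During confirmation the reference point is that of the incumbent itself, so
  every repeat is a single kernel step, and \<open>1 < r\<close> makes \<open>calls_left\<close>
  decrease.\<close>

definition state_inv :: "(real ^ 'n, real ^ 'r, 'i) bc_state \<Rightarrow> bool" where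
  "state_inv s \<longleftrightarrow>
     finite (dom (labels s)) \<and> dom (chains s) = dom (labels s) \<and>
     (\<forall>z j. labels s z = Some j \<longrightarrow> 1 \<le> j) \<and>
     (\<forall>z c. chains s z = Some c \<longrightarrow> 1 \<le> calls c \<longrightarrow> gap (z + ref_pt c)) \<and>
     (\<forall>v x \<theta> q. phase s = Processing v x \<theta> q \<longrightarrow>
        gap x \<and> master_feasible D (pool s) x \<theta> \<and> z_part D x \<in> dom (labels s) \<and>
        (\<forall>r. q = Some r \<longrightarrow> 1 < r \<and> 1 \<le> calls (the (chains s (z_part D x))) \<and>
           ref_pt (the (chains s (z_part D x))) = c_part D x))"

definition false_cert :: "(real ^ 'n, real ^ 'r, 'i) bc_state \<Rightarrow> 'i \<Rightarrow> bool" where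
  "false_cert s i \<longleftrightarrow> (\<exists>v x \<theta> q. phase s = Processing v x \<theta> q \<and> Q D x (scen D i) \<le> \<theta> \<and>
     risk D A (after_call D s x i) x q \<le> 1 \<and> \<theta> < Q_star D x)"

text \<open>Coverage refers to the true value \<open>Q_star\<close>. A false certificate only lowers
  \<open>upper\<close>, which makes coverage easier, so this invariant holds on every path;
  \<open>best_sound\<close> is what such a certificate can destroy.\<close>

definition opt_inv :: "('i \<times> (real ^ 'r)) set \<Rightarrow> (real ^ 'n, real ^ 'r, 'i) bc_state \<Rightarrow> bool" where
  "opt_inv C s \<longleftrightarrow>
     pool s \<subseteq> C \<and> (\<forall>c\<in>pool s. valid_cut D c) \<and> opn s \<subseteq> created s \<and> bounds_valid D s \<and>
     (\<forall>x\<in>feas D. (\<exists>v\<in>opn s. x \<in> region s v) \<or> upper s \<le> ereal (obj D x + Q_star D x)) \<and>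
     (upper s = \<infinity> \<and> best s = None \<or>
      (\<exists>x \<theta>. best s = Some (x, \<theta>) \<and> upper s = ereal (obj D x + \<theta>)))"

definition best_sound :: "(real ^ 'n, real ^ 'r, 'i) bc_state \<Rightarrow> bool" where
  "best_sound s \<longleftrightarrow> (\<forall>x \<theta>. best s = Some (x, \<theta>) \<longrightarrow> x \<in> feas D \<and> Q_star D x \<le> \<theta>)"

lemma state_inv_chains_after_call:
  assumes "state_inv s" "phase s = Processing v x \<theta> q"
    and "labels s' = labels s" "chains s' = chains (after_call D s x i)"
    and "phase s' = Explore \<or> (\<exists>r>1. phase s' = Processing v x \<theta> (Some r) \<and> pool s' = pool s)"
  shows "state_inv s'"
  using assms unfolding state_inv_def after_call_def
  by (auto simp: z_part_plus_c_part split: if_splits)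

lemma state_inv_step:
  assumes "state_inv s" "bc_step D A s i s'"
    and "\<And>v x \<theta> q. phase s' = Processing v x \<theta> q \<Longrightarrow> gap x"
  shows "state_inv s'"
  using assms(2)
proof cases
  case stay
  then show ?thesis
    using assms(1) by simp
next
  case (tree N O' R B v W)
  then show ?thesis
    using assms(1) by (simp add: state_inv_def)
next
  case (encounter v x \<theta> z i0)
  have "gap x"
    using assms(3) encounter by simp
  then show ?thesis
    using assms(1) encounter unfolding state_inv_def
    by (auto simp: insert_absorb split: if_splits)
next
  case (call_cut v x \<theta> q \<pi> B)
  then show ?thesis
    using assms(1) by (intro state_inv_chains_after_call[of s v x \<theta> q s' i]) (simp_all add: after_call_def)
next
  case (call_certify v x \<theta> q improving N O' R B W)
  then show ?thesis
    using assms(1) by (intro state_inv_chains_after_call[of s v x \<theta> q s' i]) (simp_all add: after_call_def)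
next
  case (call_again v x \<theta> q)
  then show ?thesis
    using assms(1) by (intro state_inv_chains_after_call[of s v x \<theta> q s' i]) (simp_all add: after_call_def)
qed

lemma state_inv_init: "bc_init D s \<Longrightarrow> state_inv s"
  by (simp add: bc_init_def state_inv_def)

text \<open>Since all cuts in the pool are valid, the pair of \<open>x\<close> and
  \<open>Q_star D x\<close> is master feasible, so exactness of the node replacement applies to
  it.\<close>

lemma covered_node_replaced:
  assumes "node_replaced D v W s s'" "opt_inv C s" "upper s' \<le> upper s" "x \<in> feas D"
  shows "(\<exists>v\<in>opn s'. x \<in> region s' v) \<or> upper s' \<le> ereal (obj D x + Q_star D x)"
proof -
  have W: "opn s' = (opn s - {v}) \<union> W" "\<forall>u\<in>created s. region s' u = region s u"
    "\<forall>x \<theta>. x \<in> region s v \<and> master_feasible D (pool s) x \<theta> \<longrightarrow>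
        (\<exists>w\<in>W. x \<in> region s' w) \<or> upper s' \<le> ereal (obj D x + \<theta>)"
    using assms(1) by (simp_all add: node_replaced_def)
  have mf: "master_feasible D (pool s) x (Q_star D x)"
    using assms(2,4) unfolding master_feasible_def opt_inv_def valid_cut_def by auto
  have "opn s \<subseteq> created s"
    "(\<exists>u\<in>opn s. x \<in> region s u) \<or> upper s \<le> ereal (obj D x + Q_star D x)"
    using assms(2,4) by (auto simp: opt_inv_def)
  then show ?thesis
  proof (elim disjE bexE)
    fix u assume u: "u \<in> opn s" "x \<in> region s u"
    show ?thesis
    proof (cases "u = v")
      case True
      then show ?thesis
        using W(1,3) mf u by blast
    next
      case False
      then have "u \<in> opn s'" "x \<in> region s' u"
        using W(1,2) u \<open>opn s \<subseteq> created s\<close> by auto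
      then show ?thesis
        by blast
    qed
  next
    assume "upper s \<le> ereal (obj D x + Q_star D x)"
    then show ?thesis
      using assms(3) by (meson order_trans)
  qed
qed

lemma opt_inv_node_replaced:
  assumes "node_replaced D v W s s'" "opt_inv C s" "pool s' = pool s" "upper s' \<le> upper s"
    and "upper s' = \<infinity> \<and> best s' = None \<or>
      (\<exists>x \<theta>. best s' = Some (x, \<theta>) \<and> upper s' = ereal (obj D x + \<theta>))"
  shows "opt_inv C s'"
  using covered_node_replaced[OF assms(1,2,4)] assms
  unfolding opt_inv_def node_replaced_def by auto

lemma opt_inv_step:
  assumes "opt_inv C s" "bc_step D A s i s'" "state_inv s"
    and recourse_finite: "\<And>x i. x \<in> feas D \<Longrightarrow> Q_finite D x (scen D i)"
    and "UNIV \<times> {\<pi>. \<pi> extreme_point_of dual_poly D} \<subseteq> C"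
  shows "opt_inv C s'"
  using assms(2)
proof cases
  case stay
  then show ?thesis
    using assms(1) by simp
next
  case (tree N O' R B v W)
  show ?thesis
    by (rule opt_inv_node_replaced[OF tree(4) assms(1)])
       (use assms(1) tree(3) in \<open>auto simp: opt_inv_def\<close>)
next
  case (encounter v x \<theta> z i0)
  then show ?thesis
    using assms(1) by (simp add: opt_inv_def bounds_valid_def)
next
  case (call_cut v x \<theta> q \<pi> B)
  have "\<pi> \<in> dual_poly D"
    using call_cut(3) by (simp add: cut_choice_def extreme_point_of_def)
  then have "valid_cut D (i, \<pi>)"
    using cut_val_le_Q recourse_finite Q_le_Q_star
    by (fastforce simp: valid_cut_def intro: order_trans)
  moreover have "(i, \<pi>) \<in> C"
    using assms(5) call_cut(3) by (auto simp: cut_choice_def)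
  ultimately show ?thesis
    using assms(1) call_cut(4,5) by (simp add: opt_inv_def after_call_def)
next
  case (call_certify v x \<theta> q improving N O' R B W)
  show ?thesis
    by (rule opt_inv_node_replaced[OF call_certify(6) assms(1)])
       (use assms(1) call_certify(4,5) in \<open>auto simp: opt_inv_def after_call_def\<close>)
next
  case (call_again v x \<theta> q)
  then show ?thesis
    using assms(1) by (simp add: opt_inv_def bounds_valid_def after_call_def)
qed

lemma opt_inv_init:
  assumes "bc_init D s" "pool s \<subseteq> C"
  shows "opt_inv C s"
  using assms by (auto simp: bc_init_def opt_inv_def)

lemma best_sound_step:
  assumes "best_sound s" "state_inv s" "bc_step D A s i s'" "\<not> false_cert s i"
  shows "best_sound s'"
  using assms(3)
proof cases
  case (call_certify v x \<theta> q improving N O' R B W)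
  have "x \<in> feas D"
    using assms(2) call_certify(1) by (auto simp: state_inv_def gap_def)
  moreover have "Q_star D x \<le> \<theta>"
    using assms(4) call_certify(1-3) by (force simp: false_cert_def)
  ultimately show ?thesis
    using assms(1) call_certify(5) by (simp add: best_sound_def after_call_def)
qed (use assms(1) in \<open>simp_all add: best_sound_def after_call_def\<close>)

lemma lower_le:
  assumes "opt_inv C s" "x \<in> feas D"
  shows "lower s \<le> ereal (obj D x + Q_star D x)"
proof -
  have mf: "master_feasible D (pool s) x (Q_star D x)"
    using assms unfolding master_feasible_def opt_inv_def valid_cut_def by auto
  have "(\<exists>v\<in>opn s. x \<in> region s v) \<or> upper s \<le> ereal (obj D x + Q_star D x)"
    using assms by (auto simp: opt_inv_def)
  then show ?thesis
  proof (elim disjE bexE)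
    fix v assume v: "v \<in> opn s" "x \<in> region s v"
    then have "bound s v \<le> ereal (obj D x + Q_star D x)"
      using assms(1) mf by (auto simp: opt_inv_def bounds_valid_def)
    then show ?thesis
      unfolding lower_def using v(1) by (meson INF_lower2 min.coboundedI2)
  qed (simp add: lower_def min.coboundedI1)
qed

lemma stopped_gap:
  assumes "stopped A s" "opt_inv C s" "x0 \<in> feas D"
  obtains x \<theta> where "best s = Some (x, \<theta>)" "obj D x + \<theta> \<le> obj D x0 + Q_star D x0 + eps_opt A"
proof -
  have le: "upper s - lower s \<le> ereal (eps_opt A)"
    using assms(1) by (simp add: stopped_def not_less)
  have low: "lower s \<le> ereal (obj D x0 + Q_star D x0)"
    by (rule lower_le[OF assms(2,3)])
  \<comment> \<open>In \<open>ereal\<close>, infinity minus anything is infinity, so a small gap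
    means that some incumbent has been accepted.\<close>
  have "upper s \<noteq> \<infinity>"
    using le by auto
  then obtain x \<theta> where *: "best s = Some (x, \<theta>)" "upper s = ereal (obj D x + \<theta>)"
    using assms(2) by (auto simp: opt_inv_def)
  then have "obj D x + \<theta> \<le> obj D x0 + Q_star D x0 + eps_opt A"
    using le low by (cases "lower s") auto
  with * that show thesis
    by blast
qed

section \<open>Termination\<close>

definition calls_left :: "real \<Rightarrow> nat" where
  "calls_left r = (LEAST n. rho A ^ n * r \<le> 1)"

lemma calls_left_less:
  assumes "1 < r"
  shows "calls_left (rho A * r) < calls_left r"
proof -
  obtain n where "rho A ^ n < 1 / r"
    using real_arch_pow_inv[of "1 / r" "rho A"] rho_lt_1 assms by auto
  then have "rho A ^ n * r \<le> 1"
    using assms by (simp add: field_simps)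
  then have left: "rho A ^ calls_left r * r \<le> 1"
    unfolding calls_left_def by (rule LeastI)
  then have "calls_left r \<noteq> 0"
    using assms by (metis mult_1 not_le power_0)
  then obtain m where m: "calls_left r = Suc m"
    using not0_implies_Suc by blast
  then have "rho A ^ m * (rho A * r) \<le> 1"
    using left by (simp add: mult_ac)
  then have "calls_left (rho A * r) \<le> m"
    unfolding calls_left_def by (rule Least_le)
  then show ?thesis
    using m by simp
qed

text \<open>An encounter changes neither tree nor pool, so the phases are ordered by their
  succession. The return to \<open>Explore\<close> raises this rank, but it comes with a new cut or
  a closed node, which counts first in \<open>progress\<close>.\<close>

fun phase_rank :: "(real ^ 'n) phase \<Rightarrow> nat \<times> nat" where
  "phase_rank Explore = (2, 0)"
| "phase_rank (Processing v x \<theta> None) = (1, 0)"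
| "phase_rank (Processing v x \<theta> (Some r)) = (0, calls_left r)"

(* Closed nodes stay closed and cuts stay in the pool. *)
definition progress ::
    "nat set \<Rightarrow> ('i \<times> (real ^ 'r)) set \<Rightarrow> (real ^ 'n, real ^ 'r, 'i) bc_state \<Rightarrow> nat \<times> nat \<times> nat" where
  "progress N C s = (card (N - (created s - opn s)) + card (C - pool s), phase_rank (phase s))"

text \<open>The children are fresh and open, so a replacement adds exactly \<open>v\<close> to the
  closed nodes.\<close>

lemma card_closed_decreases:
  assumes "node_replaced D v W s s'" "finite N" "created s' \<subseteq> N" "opn s \<subseteq> created s"
  shows "card (N - (created s' - opn s')) < card (N - (created s - opn s))"
proof (rule psubset_card_mono)
  have *: "v \<in> opn s" "W \<inter> created s = {}" "created s' = created s \<union> W"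
    "opn s' = (opn s - {v}) \<union> W"
    using assms(1) by (simp_all add: node_replaced_def)
  have "created s' - opn s' = insert v (created s - opn s)"
    using * assms(4) by auto
  moreover have "v \<in> N"
    using * assms by auto
  ultimately show "N - (created s' - opn s') \<subset> N - (created s - opn s)"
    using *(1) by auto
qed (use assms(2) in simp)

lemma progress_decreases:
  assumes "bc_step D A s i s'" "\<not> stopped A s" "state_inv s" "opt_inv C s"
    and recourse_finite: "\<And>x i. x \<in> feas D \<Longrightarrow> Q_finite D x (scen D i)"
    and "UNIV \<times> {\<pi>. \<pi> extreme_point_of dual_poly D} \<subseteq> C" "finite C"
    and "finite N" "created s' \<subseteq> N"
  shows "(progress N C s', progress N C s) \<in> less_than <*lex*> less_than <*lex*> less_than"
  using assms(1)
proof cases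
  case stay
  then show ?thesis
    using assms(2) by simp
next
  case (tree N' O' R B v W)
  then show ?thesis
    using card_closed_decreases[OF tree(4) assms(8,9)] assms(4)
    by (simp add: progress_def opt_inv_def)
next
  case (encounter v x \<theta> z i0)
  then show ?thesis
    by (simp add: progress_def)
next
  case (call_cut v x \<theta> q \<pi> B)
  have x: "x \<in> feas D" "master_feasible D (pool s) x \<theta>"
    using assms(3) call_cut(1) by (auto simp: state_inv_def gap_def)
  \<comment> \<open>All cuts in the pool respect \<open>\<theta>\<close> at the incumbent, so a cut
    above \<open>\<theta>\<close> is not among them.\<close>
  have "\<theta> < cut_val D i \<pi> x"
    using Q_le_cut_choice[OF call_cut(3) recourse_finite[OF x(1)]] call_cut(2) by simp
  then have "(i, \<pi>) \<notin> pool s"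
    using x(2) by (auto simp: master_feasible_def)
  moreover have "(i, \<pi>) \<in> C"
    using assms(6) call_cut(3) by (auto simp: cut_choice_def)
  ultimately have "card (C - insert (i, \<pi>) (pool s)) < card (C - pool s)"
    using assms(7) by (intro psubset_card_mono) auto
  then show ?thesis
    using call_cut by (simp add: progress_def after_call_def)
next
  case (call_certify v x \<theta> q improving N' O' R B W)
  then show ?thesis
    using card_closed_decreases[OF call_certify(6) assms(8,9)] assms(4)
    by (simp add: progress_def opt_inv_def after_call_def)
next
  case (call_again v x \<theta> q)
  show ?thesis
  proof (cases q)
    case None
    then show ?thesis
      using call_again by (simp add: progress_def after_call_def)
  next
    case (Some r)
    have "1 < r"
      using assms(3) call_again(1) Some by (simp add: state_inv_def)
    then show ?thesis
      using calls_left_less[of r] call_again Some by (simp add: progress_def after_call_def risk_def)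
  qed
qed

end

section \<open>Deterministic consequences along a single path: termination and optimality\<close>

locale bc_path = separation_oracle D A
  for D :: "('n::finite, 'y::finite, 'r::finite, 'u::finite, 'i::finite) two_stage"
    and A :: "('n, 'i) oracle_spec" +
  fixes S :: "nat \<Rightarrow> (real ^ 'n, real ^ 'r, 'i) bc_state" and I :: "nat \<Rightarrow> 'i"
  assumes recourse_finite: "x \<in> feas D \<Longrightarrow> Q_finite D x (scen D i)"
    and run: "bc_run D A S I"
    and path_gap: "phase (S t) = Processing v x \<theta> q \<Longrightarrow> j \<notin> I_star D x \<Longrightarrow>
          Q_star D x - Q D x (scen D j) \<ge> Delta A"
    and finite_tree: "finite (\<Union>t. created (S t))"
begin

lemma step: "bc_step D A (S t) (I t) (S (Suc t))"
  using run by (simp add: bc_run_def)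

lemma init: "bc_init D (S 0)"
  using run by (simp add: bc_run_def)

lemma processing_feasible:
  "phase (S t) = Processing v x \<theta> q \<Longrightarrow> x \<in> feas D"
proof (induction t arbitrary: v x \<theta> q)
  case 0
  then show ?case
    using init by (simp add: bc_init_def)
next
  case (Suc t)
  from step[of t] show ?case
    by cases (use Suc in \<open>auto simp: after_call_def master_feasible_def\<close>)
qed

lemma processing_gap: "phase (S t) = Processing v x \<theta> q \<Longrightarrow> gap x"
  using path_gap processing_feasible by (auto simp: gap_def)

lemma state_inv: "state_inv (S t)"
proof (induction t)
  case 0
  then show ?case
    by (rule state_inv_init[OF init])
next
  case (Suc t)
  show ?case
    by (rule state_inv_step[OF Suc step processing_gap])
qed

definition cuts :: "('i \<times> (real ^ 'r)) set" where
  "cuts = pool (S 0) \<union> UNIV \<times> {\<pi>. \<pi> extreme_point_of dual_poly D}"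

lemma finite_cuts: "finite cuts"
  using init finite_extreme_dual unfolding cuts_def bc_init_def
  by (intro finite_UnI finite_cartesian_product) simp_all

lemma opt_inv: "opt_inv cuts (S t)"
proof (induction t)
  case 0
  then show ?case
    by (rule opt_inv_init[OF init]) (simp add: cuts_def)
next
  case (Suc t)
  show ?case
    by (rule opt_inv_step[OF Suc step state_inv recourse_finite]) (auto simp: cuts_def)
qed

lemma terminates: "\<exists>t. stopped A (S t)"
proof (rule ccontr)
  assume "\<nexists>t. stopped A (S t)"
  then have "(progress (\<Union>t. created (S t)) cuts (S (Suc t)), progress (\<Union>t. created (S t)) cuts (S t))
      \<in> less_than <*lex*> less_than <*lex*> less_than" for t
    by (intro progress_decreases[OF step _ state_inv opt_inv recourse_finite])
       (use finite_cuts finite_tree in \<open>auto simp: cuts_def\<close>)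
  moreover have "wf (less_than <*lex*> less_than <*lex*> less_than)"
    by (intro wf_lex_prod wf_less_than)
  ultimately show False
    using wf_no_infinite_down_chainE[where f = "\<lambda>t. progress (\<Union>t. created (S t)) cuts (S t)"] by blast
qed

lemma best_sound:
  assumes "\<And>t. \<not> false_cert (S t) (I t)"
  shows "best_sound (S t)"
proof (induction t)
  case 0
  then show ?case
    using init by (simp add: bc_init_def best_sound_def)
next
  case (Suc t)
  show ?case
    by (rule best_sound_step[OF Suc state_inv step assms])
qed

lemma returned_solution:
  assumes "is_arg_min (\<lambda>x. obj D x + Q_star D x) (\<lambda>x. x \<in> feas D) x0"
    and "\<And>t. \<not> false_cert (S t) (I t)"
  shows "\<exists>t x \<theta>. stopped A (S t) \<and> best (S t) = Some (x, \<theta>) \<and>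
    0 \<le> (obj D x + \<theta>) - F_star D \<and> (obj D x + \<theta>) - F_star D \<le> eps_opt A"
proof -
  have x0: "x0 \<in> feas D" "\<And>x. x \<in> feas D \<Longrightarrow> obj D x0 + Q_star D x0 \<le> obj D x + Q_star D x"
    using assms(1) by (auto simp: is_arg_min_linorder)
  then have F_star: "F_star D = obj D x0 + Q_star D x0"
    unfolding F_star_def by (intro cInf_eq_minimum) auto
  obtain t where t: "stopped A (S t)"
    using terminates by blast
  obtain x \<theta> where x: "best (S t) = Some (x, \<theta>)"
    "obj D x + \<theta> \<le> obj D x0 + Q_star D x0 + eps_opt A"
    using stopped_gap[OF t opt_inv x0(1)] .
  moreover have "x \<in> feas D" "Q_star D x \<le> \<theta>"
    using best_sound[OF assms(2), of t] x(1) by (auto simp: best_sound_def)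
  ultimately show ?thesis
    using t x0(2)[of x] F_star by (intro exI[of _ t] exI[of _ x] exI[of _ \<theta>]) auto
qed

end

section \<open>The risk potential\<close>

context separation_oracle
begin

text \<open>Part of the error budget reserved for call \<open>k\<close> of chain \<open>j\<close>;
  its reciprocal is the weight in front of the minimum in the initial risk value.\<close>

definition share :: "nat \<Rightarrow> nat \<Rightarrow> real" where
  "share j k = eps_false A / (real j * (real j + 1) * real k * (real k + 1))"

text \<open>The telescoped sum of the shares of all calls after the first \<open>k\<close>.\<close>

definition reserve :: "nat \<Rightarrow> nat \<Rightarrow> real" where
  "reserve j k = eps_false A / (real j * (real j + 1) * (real k + 1))"

definition bad_cost :: "nat \<Rightarrow> nat \<Rightarrow> real" where
  "bad_cost j k = share j k / risk_seq k"

definition bad :: "real ^ 'n \<Rightarrow> (real ^ 'n, 'i) chain \<Rightarrow> bool" where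
  "bad z c \<longleftrightarrow> 1 \<le> calls c \<and> cur c \<notin> I_star D (z + ref_pt c)"

text \<open>An incumbent with \<open>Q_star D x \<le> \<theta>\<close> cannot be certified falsely,
  so its confirmation is not charged.\<close>

definition pending :: "(real ^ 'n, real ^ 'r, 'i) bc_state \<Rightarrow> real ^ 'n \<Rightarrow> real option" where
  "pending s z = (case phase s of
     Explore \<Rightarrow> None
   | Processing v x \<theta> q \<Rightarrow> if z = z_part D x \<and> \<theta> < Q_star D x then q else None)"

text \<open>A pending wrong incumbent has passed its last call, so the state is bad as well. A
  maximum suffices because both surcharges are caused by the same sample.\<close>

definition chain_pot :: "nat \<Rightarrow> real ^ 'n \<Rightarrow> (real ^ 'n, 'i) chain \<Rightarrow> real option \<Rightarrow> real" where
  "chain_pot j z c q = reserve j (calls c) + (case q of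
     Some r \<Rightarrow> max (1 / r) (bad_cost j (calls c))
   | None \<Rightarrow> if bad z c then bad_cost j (calls c) else 0)"

definition pot_at :: "(real ^ 'n, real ^ 'r, 'i) bc_state \<Rightarrow> real ^ 'n \<Rightarrow> real" where
  "pot_at s z = chain_pot (the (labels s z)) z (the (chains s z)) (pending s z)"

(* An adaptive adversary can make the conditional failure probability of a single call exceed
   delta_hat.  What survives is this supermartingale: each chain keeps its unspent share of the
   error budget, plus a surcharge while its state is not an argmax scenario or while a wrong
   incumbent is being confirmed. *)
definition pot :: "(real ^ 'n, real ^ 'r, 'i) bc_state \<Rightarrow> real" where
  "pot s = (\<Sum>z\<in>dom (labels s). pot_at s z) + eps_false A / (real (card (dom (labels s))) + 1)"

lemma share_pos: "1 \<le> j \<Longrightarrow> 1 \<le> k \<Longrightarrow> 0 < share j k"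
  using eps_false_pos by (simp add: share_def)

lemma reserve_pos: "1 \<le> j \<Longrightarrow> 0 < reserve j k"
  using eps_false_pos by (simp add: reserve_def)

lemma reserve_Suc:
  assumes "1 \<le> j"
  shows "reserve j k = reserve j (Suc k) + share j (Suc k)"
proof -
  have "eps_false A / (c * (k' + 1)) = eps_false A / (c * (k' + 2)) + eps_false A / (c * (k' + 1) * (k' + 2))"
    if "0 < c" "0 \<le> k'" for c k' :: real
    using that by (simp add: divide_simps) (simp add: algebra_simps)
  from this[of "real j * (real j + 1)" "real k"] show ?thesis
    using assms by (simp add: reserve_def share_def add.commute)
qed

lemma share_antimono:
  assumes "1 \<le> k"
  shows "share j (Suc k) \<le> share j k"
proof (cases "j = 0")
  case False
  then show ?thesis
    unfolding share_def using assms eps_false_pos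
    by (intro divide_left_mono mult_mono mult_pos_pos) auto
qed (simp add: share_def)

lemma bad_cost_nonneg: "0 \<le> bad_cost j k"
  unfolding bad_cost_def share_def using eps_false_pos risk_seq_pos[of k] by simp

text \<open>Pays for a call from a bad state. With b, b' the risks before and after, b' * (1 + 1 /
  b) \<ge> rho + eta * b + tail / b \<ge> rho, and rho < 1 settles the case where the minimum is
  1.\<close>

lemma rho_div_le:
  assumes "1 \<le> k" "1 \<le> j"
  shows "rho A * (share j (Suc k) / min 1 (risk_seq (Suc k))) \<le> share j (Suc k) + bad_cost j k"
proof -
  define b where "b = risk_seq k"
  define b' where "b' = risk_seq (Suc k)"
  have b: "0 < b" "0 < b'"
    unfolding b_def b'_def by (rule risk_seq_pos)+
  have "gibbs_tail A + eta A * b \<le> b'"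
    using drift_nonneg[of k] by (simp add: b_def b'_def)
  then have "(gibbs_tail A + eta A * b) * (1 + 1 / b) \<le> b' * (1 + 1 / b)"
    using b by (intro mult_right_mono) auto
  moreover have "(gibbs_tail A + eta A * b) * (1 + 1 / b) = rho A + eta A * b + gibbs_tail A / b"
    using b by (simp add: rho_def field_simps)
  ultimately have "rho A \<le> b' * (1 + 1 / b)"
    using b eta_pos gibbs_tail_pos by (smt (verit) divide_pos_pos mult_pos_pos)
  moreover have "rho A \<le> 1 + 1 / b"
    using rho_lt_1 b by (smt (verit) divide_pos_pos)
  ultimately have *: "rho A / min 1 b' \<le> 1 + 1 / b"
    using b by (auto simp: min_def divide_le_eq mult.commute)
  have "rho A * (share j (Suc k) / min 1 b') = share j (Suc k) * (rho A / min 1 b')"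
    by simp
  also have "\<dots> \<le> share j (Suc k) * (1 + 1 / b)"
    using * share_pos[of j "Suc k"] assms by (intro mult_left_mono) auto
  also have "\<dots> = share j (Suc k) + share j (Suc k) / b"
    by (simp add: algebra_simps)
  also have "share j (Suc k) / b \<le> bad_cost j k"
    unfolding bad_cost_def b_def[symmetric] using share_antimono[OF assms(1)] b
    by (intro divide_right_mono) auto
  finally show ?thesis
    by (simp add: b'_def)
qed

lemma bad_cost_le_div_min: "bad_cost j k \<le> share j k / min 1 (risk_seq k)"
  unfolding bad_cost_def using risk_seq_pos[of k] eps_false_pos
  by (intro divide_left_mono) (auto simp: share_def min_def)

text \<open>A far call mixes for \<open>g\<close> steps from any state. A near call is one step: an
  argmax state escapes with the Gibbs tail, and a state that stopped being argmax through the change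
  of incumbent is covered by the drift. Only a state that was already bad is left with rho; its
  surcharge pays for that.\<close>

lemma failure_prob:
  assumes "gap x" "1 \<le> calls c" "gap (z_part D x + ref_pt c)"
  defines "f \<equiv> measure_pmf.prob (kernel_pow (kern A x) (call_steps D A c x) (cur c)) (- I_star D x)"
  shows "f \<le> limit_risk + drift (calls c) \<or> (bad (z_part D x) c \<and> f \<le> rho A)"
proof (cases "norm (c_part D x - ref_pt c) \<le> c0 A * real (calls c) powr (- decay A)")
  case True
  then have f: "f = measure_pmf.prob (kern A x (cur c)) (- I_star D x)"
    using assms(2) by (simp add: f_def call_steps_def max_def bind_return_pmf)
  \<comment> \<open>Both incumbents share their integer part, so the oracle's distance test measures
    the full distance between them.\<close>
  have x: "x - (z_part D x + ref_pt c) = c_part D x - ref_pt c"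
    by (metis z_part_plus_c_part add_diff_cancel_left)
  show ?thesis
  proof (cases "cur c \<in> I_star D x")
    case True
    have "f \<le> gibbs_tail A"
      unfolding f by (rule escape_from_argmax[OF assms(1) True])
    also have "\<dots> \<le> limit_risk + drift (calls c)"
      using limit_risk_fixed limit_risk_pos eta_pos drift_nonneg[of "calls c"]
      by (smt (verit) mult_nonneg_nonneg)
    finally show ?thesis ..
  next
    case changed: False
    have rho: "f \<le> rho A"
      unfolding f by (rule escape_step_rho[OF assms(1)])
    show ?thesis
    proof (cases "bad (z_part D x) c")
      case False
      then have "cur c \<in> I_star D (z_part D x + ref_pt c)"
        using assms(2) by (simp add: bad_def)
      then have "eta A \<le> drift (calls c)"
        using near_drift[OF assms(3,1) _ changed] True x by simp
      moreover have "gibbs_tail A \<le> limit_risk"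
        using limit_risk_fixed limit_risk_pos eta_pos by (smt (verit) mult_nonneg_nonneg)
      ultimately show ?thesis
        using rho by (simp add: rho_def)
    qed (use rho in simp)
  qed
next
  case False
  then have "call_steps D A c x = g A (calls c)"
    using assms(2) by (simp add: call_steps_def max_def)
  then have "f \<le> limit_risk + eta A ^ g A (calls c) * indicator (- I_star D x) (cur c)"
    using escape_pow[OF assms(1)] by (simp add: f_def)
  also have "\<dots> \<le> limit_risk + drift (calls c)"
    using far_drift[OF assms(2)] eta_pos drift_nonneg[of "calls c"]
    by (cases "cur c \<in> I_star D x") auto
  finally show ?thesis ..
qed

text \<open>Expected cost of one call when failure has the highest price a first call can incur: it
  is met by the share released by this call and the surcharge already held.\<close>

lemma failure_charge:
  assumes "gap x" "1 \<le> j" "1 \<le> calls c \<Longrightarrow> gap (z_part D x + ref_pt c)"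
  defines "f \<equiv> measure_pmf.prob (kernel_pow (kern A x) (call_steps D A c x) (cur c)) (- I_star D x)"
  shows "f * (share j (Suc (calls c)) / min 1 (risk_seq (Suc (calls c))))
    \<le> share j (Suc (calls c)) + (if bad (z_part D x) c then bad_cost j (calls c) else 0)"
proof -
  let ?e = "share j (Suc (calls c))" and ?b = "risk_seq (Suc (calls c))"
  have e: "0 < ?e"
    using share_pos assms(2) by simp
  have b: "0 < min 1 ?b"
    using risk_seq_pos[of "Suc (calls c)"] by simp
  have f: "0 \<le> f" "f \<le> 1"
    by (simp_all add: f_def)
  have charge: "f * (?e / min 1 ?b) \<le> ?e" if "f \<le> ?b"
  proof -
    have "f / min 1 ?b \<le> 1"
      using b f that by (auto simp: divide_le_eq)
    then have "?e * (f / min 1 ?b) \<le> ?e * 1"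
      using e by (intro mult_left_mono) auto
    then show ?thesis
      by (simp add: mult.commute)
  qed
  show ?thesis
  proof (cases "calls c = 0")
    case True
    \<comment> \<open>On the first call of a chain the risk bound exceeds 1 and holds
      trivially.\<close>
    then have "f \<le> ?b"
      using f risk_seq_1 limit_risk_pos by (simp del: risk_seq.simps)
    then show ?thesis
      using charge bad_cost_nonneg[of j "calls c"] by (auto intro: add_increasing2)
  next
    case False
    then have k: "1 \<le> calls c"
      by simp
    from failure_prob[OF assms(1) k assms(3)[OF k]] show ?thesis
    proof
      assume "measure_pmf.prob (kernel_pow (kern A x) (call_steps D A c x) (cur c)) (- I_star D x)
        \<le> limit_risk + drift (calls c)"
      then have "f \<le> ?b"
        using risk_seq_Suc_ge[of "calls c"] by (simp add: f_def del: risk_seq.simps)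
      then show ?thesis
        using charge bad_cost_nonneg[of j "calls c"] by (auto intro: add_increasing2)
    next
      assume *: "bad (z_part D x) c \<and> measure_pmf.prob
        (kernel_pow (kern A x) (call_steps D A c x) (cur c)) (- I_star D x) \<le> rho A"
      have "f * (?e / min 1 ?b) \<le> rho A * (?e / min 1 ?b)"
        using * e b by (intro mult_right_mono) (auto simp: f_def simp del: risk_seq.simps)
      also have "\<dots> \<le> ?e + bad_cost j (calls c)"
        by (rule rho_div_le[OF k assms(2)])
      finally show ?thesis
        using * by simp
    qed
  qed
qed

text \<open>The risk value depends on label and call count but not on the sample, so any scenario,
  here \<open>undefined\<close>, can stand in and the value is known before sampling.\<close>

definition next_risk :: "(real ^ 'n, real ^ 'r, 'i) bc_state \<Rightarrow> real ^ 'n \<Rightarrow> real option \<Rightarrow> real" where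
  "next_risk s x q = risk D A (after_call D s x undefined) x q"

lemma risk_after_call: "risk D A (after_call D s x i) x q = next_risk s x q"
  unfolding next_risk_def by (cases q) (simp_all add: risk_def after_call_def)

lemma next_risk_None:
  assumes "1 \<le> the (labels s (z_part D x))"
  shows "next_risk s x None =
    min 1 (delta_hat A (Suc (calls (the (chains s (z_part D x)))))) /
    share (the (labels s (z_part D x))) (Suc (calls (the (chains s (z_part D x)))))"
  using assms eps_false_pos by (simp add: next_risk_def risk_def after_call_def share_def Let_def)

definition fail_cost :: "(real ^ 'n, real ^ 'r, 'i) bc_state \<Rightarrow> real ^ 'n \<Rightarrow> real \<Rightarrow> real option \<Rightarrow> real" where
  "fail_cost s x \<theta> q =
    (let b = bad_cost (the (labels s (z_part D x))) (Suc (calls (the (chains s (z_part D x)))))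
     in if \<theta> < Q_star D x then max (1 / next_risk s x q) b else b)"

text \<open>Majorant of the potential after the step that depends only on the present state and the
  sample, not on later decisions such as the tree or the returned cut. The conditional law of the
  sample can therefore be applied to it.\<close>

definition next_pot :: "(real ^ 'n, real ^ 'r, 'i) bc_state \<Rightarrow> 'i \<Rightarrow> real" where
  "next_pot s i = (case phase s of
     Explore \<Rightarrow> pot s
   | Processing v x \<theta> q \<Rightarrow> pot s - pot_at s (z_part D x)
       + reserve (the (labels s (z_part D x))) (Suc (calls (the (chains s (z_part D x)))))
       + fail_cost s x \<theta> q * indicator (- I_star D x) i)"

lemma chain_pot_nonneg:
  assumes "1 \<le> j" "\<And>r. q = Some r \<Longrightarrow> 0 < r"
  shows "0 \<le> chain_pot j z c q"
  using reserve_pos[OF assms(1), of "calls c"] bad_cost_nonneg[of j "calls c"] assms(2)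
  by (auto simp: chain_pot_def max_def split: option.split intro!: add_nonneg_nonneg)

lemma pot_at_nonneg:
  assumes "state_inv s" "z \<in> dom (labels s)"
  shows "0 \<le> pot_at s z"
  unfolding pot_at_def
proof (rule chain_pot_nonneg)
  show "1 \<le> the (labels s z)"
    using assms by (auto simp: state_inv_def)
  show "0 < r" if "pending s z = Some r" for r
    using that assms(1) by (force simp: pending_def state_inv_def split: phase.splits if_splits)
qed

lemma pot_split:
  assumes "finite (dom (labels s))" "z \<in> dom (labels s)"
  shows "pot s - pot_at s z = (\<Sum>z\<in>dom (labels s) - {z}. pot_at s z)
    + eps_false A / (real (card (dom (labels s))) + 1)"
  unfolding pot_def by (subst sum.remove[OF assms]) simp

lemma next_risk_pos:
  assumes "state_inv s" "phase s = Processing v x \<theta> q"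
  shows "0 < next_risk s x q"
proof (cases q)
  case None
  obtain j where j: "labels s (z_part D x) = Some j" "1 \<le> j"
    using assms by (force simp: state_inv_def)
  let ?k = "Suc (calls (the (chains s (z_part D x))))"
  have "0 < delta_hat A ?k"
    using risk_seq_le_delta_hat[of ?k] risk_seq_pos[of ?k] by linarith
  then show ?thesis
    using next_risk_None[of s x] None j share_pos[of j ?k] by simp
next
  case (Some r)
  then show ?thesis
    using assms rho_pos by (auto simp: state_inv_def next_risk_def risk_def)
qed

lemma fail_cost_nonneg: "0 \<le> fail_cost s x \<theta> q"
  unfolding fail_cost_def Let_def by (simp add: le_max_iff_disj bad_cost_nonneg)

text \<open>Only the chain being called changes, so the expected failure cost has to fit into its
  old potential minus its new reserve. First calls and correct incumbents use
  \<open>failure_charge\<close>; repeats for a wrong incumbent use the rho bound.\<close>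

lemma next_pot_expectation:
  assumes "state_inv s" "phase s = Processing v x \<theta> q"
  shows "(\<Sum>i\<in>UNIV. pmf (call_law D A s x) i * next_pot s i) \<le> pot s"
proof -
  define z where "z = z_part D x"
  obtain j c where j: "labels s z = Some j" "1 \<le> j" and c: "chains s z = Some c"
    using assms by (force simp: state_inv_def z_def)
  let ?k = "calls c"
  have gap: "gap x" "1 \<le> ?k \<Longrightarrow> gap (z + ref_pt c)"
    using assms c by (auto simp: state_inv_def)
  define f where "f = measure_pmf.prob (call_law D A s x) (- I_star D x)"
  have law: "call_law D A s x = kernel_pow (kern A x) (call_steps D A c x) (cur c)"
    using c by (simp add: call_law_def z_def)
  have f: "0 \<le> f"
    by (simp add: f_def)
  have charge: "f * (share j (Suc ?k) / min 1 (risk_seq (Suc ?k)))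
      \<le> share j (Suc ?k) + (if bad z c then bad_cost j ?k else 0)"
    using failure_charge[OF gap(1) j(2), of c] gap(2) unfolding f_def law z_def by simp
  let ?W = "fail_cost s x \<theta> q"
  have cost_None: "f * ?W \<le> share j (Suc ?k) + (if bad z c then bad_cost j ?k else 0)"
    if "?W \<le> share j (Suc ?k) / min 1 (risk_seq (Suc ?k))"
    using mult_left_mono[OF that f] charge by linarith
  have "f * ?W \<le> pot_at s z - reserve j (Suc ?k)"
  proof (cases "\<theta> < Q_star D x")
    case False
    then have "?W = bad_cost j (Suc ?k)"
      using j c by (simp add: fail_cost_def z_def)
    moreover have "pending s z = None"
      using assms(2) False by (simp add: pending_def)
    ultimately show ?thesis
      using cost_None bad_cost_le_div_min[of j "Suc ?k"] reserve_Suc[OF j(2), of ?k] j c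
      by (simp add: pot_at_def chain_pot_def del: risk_seq.simps)
  next
    case True
    then have W: "?W = max (1 / next_risk s x q) (bad_cost j (Suc ?k))"
      using j c by (simp add: fail_cost_def z_def)
    have pend: "pending s z = q"
      using assms(2) True by (simp add: pending_def z_def)
    show ?thesis
    proof (cases q)
      case None
      have "1 / next_risk s x q = share j (Suc ?k) / min 1 (delta_hat A (Suc ?k))"
        using next_risk_None[of s x] None j c by (simp add: z_def)
      also have "\<dots> \<le> share j (Suc ?k) / min 1 (risk_seq (Suc ?k))"
        using risk_seq_le_delta_hat[of "Suc ?k"] risk_seq_pos[of "Suc ?k"] share_pos[OF j(2), of "Suc ?k"]
        by (intro divide_left_mono) (auto simp: min_def simp del: risk_seq.simps)
      finally have "f * ?W \<le> share j (Suc ?k) + (if bad z c then bad_cost j ?k else 0)"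
        using cost_None bad_cost_le_div_min[of j "Suc ?k"] unfolding W by simp
      then show ?thesis
        using reserve_Suc[OF j(2), of ?k] pend None j c by (simp add: pot_at_def chain_pot_def)
    next
      case (Some r)
      have r: "1 < r" "1 \<le> ?k" "ref_pt c = c_part D x"
        using assms Some c by (auto simp: state_inv_def z_def)
      \<comment> \<open>The distance to the reference point is 0, so the threshold test
        succeeds.\<close>
      then have "call_steps D A c x = 1"
        using c0_pos by (simp add: call_steps_def)
      then have "f \<le> rho A"
        unfolding f_def law using escape_step_rho[OF gap(1)] by (simp add: bind_return_pmf)
      then have "f * ?W \<le> rho A * ?W"
        using fail_cost_nonneg by (intro mult_right_mono) auto
      also have "next_risk s x q = rho A * r"
        by (simp add: next_risk_def risk_def Some)
      \<comment> \<open>The probability rho cancels the factor by which the risk value has shrunk: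
        rho / (rho * r) = 1 / r.\<close>
      then have "rho A * ?W = max (1 / r) (rho A * bad_cost j (Suc ?k))"
        unfolding W using rho_pos by (simp add: max_mult_distrib_left)
      also have "rho A * bad_cost j (Suc ?k) \<le> rho A * (share j (Suc ?k) / min 1 (risk_seq (Suc ?k)))"
        using rho_pos by (intro mult_left_mono bad_cost_le_div_min) simp
      then have "max (1 / r) (rho A * bad_cost j (Suc ?k)) \<le> share j (Suc ?k) + max (1 / r) (bad_cost j ?k)"
        using rho_div_le[OF r(2) j(2)] share_pos[OF j(2), of "Suc ?k"]
        by (simp add: max_def del: risk_seq.simps)
      finally show ?thesis
        using reserve_Suc[OF j(2), of ?k] pend Some j c by (simp add: pot_at_def chain_pot_def)
    qed
  qed
  moreover have "(\<Sum>i\<in>UNIV. pmf (call_law D A s x) i * next_pot s i)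
      = pot s - pot_at s z + reserve j (Suc ?k) + f * ?W"
  proof -
    have "(\<Sum>i\<in>UNIV. pmf (call_law D A s x) i * indicator (- I_star D x) i) = f"
      unfolding f_def prob_eq_sum_pmf by (rule sum.mono_neutral_cong_right) (auto simp: indicator_def)
    moreover have "(\<Sum>i\<in>UNIV. pmf (call_law D A s x) i * next_pot s i)
      = (\<Sum>i\<in>UNIV. pmf (call_law D A s x) i) * (pot s - pot_at s z + reserve j (Suc ?k))
        + (\<Sum>i\<in>UNIV. pmf (call_law D A s x) i * indicator (- I_star D x) i) * ?W"
      using j c assms(2) unfolding sum_distrib_right sum.distrib[symmetric]
      by (intro sum.cong) (auto simp: next_pot_def z_def algebra_simps)
    ultimately show ?thesis
      by (simp add: sum_pmf_UNIV)
  qed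
  ultimately show ?thesis
    by linarith
qed

lemma next_pot_after_call:
  assumes "state_inv s" "phase s = Processing v x \<theta> q"
    and "labels s' = labels s" "chains s' = chains (after_call D s x i)"
    and "phase s' = Explore \<or> phase s' = Processing v x \<theta> (Some (next_risk s x q)) \<and> Q D x (scen D i) \<le> \<theta>"
  shows "pot s' \<le> next_pot s i"
proof -
  define z where "z = z_part D x"
  obtain j c where j: "labels s z = Some j" "1 \<le> j" and c: "chains s z = Some c"
    using assms(1,2) by (force simp: state_inv_def z_def)
  have fin: "finite (dom (labels s))"
    using assms(1) by (simp add: state_inv_def)
  have other: "pot_at s' z' = pot_at s z'" if "z' \<noteq> z" for z'
    using that assms(2-5) by (auto simp: pot_at_def after_call_def pending_def z_def)
  have "pot_at s' z \<le> reserve j (Suc (calls c)) + fail_cost s x \<theta> q * indicator (- I_star D x) i"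
  proof -
    have c': "the (chains s' z) = \<lparr>cur = i, ref_pt = c_part D x, calls = Suc (calls c)\<rparr>"
      using assms(4) c by (simp add: after_call_def z_def)
    have bad: "bad z (the (chains s' z)) \<longleftrightarrow> i \<notin> I_star D x"
      unfolding c' by (simp add: bad_def z_def z_part_plus_c_part)
    have W: "fail_cost s x \<theta> q = (if \<theta> < Q_star D x
        then max (1 / next_risk s x q) (bad_cost j (Suc (calls c))) else bad_cost j (Suc (calls c)))"
      using j c by (simp add: fail_cost_def z_def)
    show ?thesis
    proof (cases "pending s' z")
      case None
      then show ?thesis
        using bad c' j assms(3) by (simp add: pot_at_def chain_pot_def W)
    next
      case (Some r)
      \<comment> \<open>The call passed below the true value, so the sample is no argmax scenario
        and the failure cost is indeed contained in \<open>next_pot\<close>.\<close>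
      then have "\<theta> < Q_star D x" "r = next_risk s x q" "Q D x (scen D i) \<le> \<theta>"
        using assms(5) by (auto simp: pending_def split: if_splits)
      then show ?thesis
        using Some c' j assms(3) by (auto simp: pot_at_def chain_pot_def W I_star_iff)
    qed
  qed
  moreover have "pot s' - pot_at s' z = pot s - pot_at s z"
    using other assms(3) fin j by (simp add: pot_split domI)
  ultimately show ?thesis
    using j c assms(2) by (simp add: next_pot_def z_def)
qed

lemma pot_step:
  assumes "bc_step D A s i s'" "state_inv s"
  shows "pot s' \<le> next_pot s i"
  using assms(1)
proof cases
  case stay
  then show ?thesis
    by (simp add: next_pot_def stopped_def)
next
  case (tree N O' R B v W)
  then show ?thesis
    by (simp add: next_pot_def pot_def pot_at_def pending_def)
next
  case (encounter v x \<theta> z i0)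
  have dom: "finite (dom (labels s))" "dom (chains s) = dom (labels s)"
    using assms(2) by (simp_all add: state_inv_def)
  have pending: "pending s' = pending s"
    using encounter by (simp add: pending_def fun_eq_iff)
  show ?thesis
  proof (cases "z \<in> dom (labels s)")
    case True
    then show ?thesis
      using encounter(1,6) dom pending by (simp add: next_pot_def pot_def pot_at_def)
  next
    case False
    define n where "n = card (dom (labels s))"
    have labels: "labels s' = (labels s)(z \<mapsto> Suc n)"
      "chains s' = (chains s)(z \<mapsto> \<lparr>cur = i0, ref_pt = c_part D x, calls = 0\<rparr>)"
      using encounter(6) False dom(2) by (auto simp: n_def)
    have old: "pot_at s' z' = pot_at s z'" if "z' \<in> dom (labels s)" for z'
      using that False by (auto simp: pot_at_def labels pending)
    have new: "pot_at s' z = reserve (Suc n) 0"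
      using encounter(1) by (simp add: pot_at_def labels pending chain_pot_def bad_def pending_def)
    have "pot s' = (\<Sum>z\<in>dom (labels s). pot_at s z) + (reserve (Suc n) 0 + eps_false A / (real n + 2))"
      using False dom(1) old new by (simp add: pot_def labels n_def add.commute)
    also have "reserve (Suc n) 0 + eps_false A / (real n + 2) = eps_false A / (real n + 1)"
      by (simp add: reserve_def divide_simps) (simp add: algebra_simps)
    finally show ?thesis
      using encounter(1) by (simp add: next_pot_def pot_def n_def)
  qed
next
  case (call_cut v x \<theta> q \<pi> B)
  then show ?thesis
    by (intro next_pot_after_call[OF assms(2)]) (simp_all add: after_call_def)
next
  case (call_certify v x \<theta> q improving N O' R B W)
  then show ?thesis
    by (intro next_pot_after_call[OF assms(2)]) (simp_all add: after_call_def)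
next
  case (call_again v x \<theta> q)
  then show ?thesis
    by (intro next_pot_after_call[OF assms(2) call_again(1)])
       (simp_all add: after_call_def risk_after_call[unfolded after_call_def])
qed

lemma fail_cost_le_next_pot:
  assumes "state_inv s" "phase s = Processing v x \<theta> q"
  shows "fail_cost s x \<theta> q * indicator (- I_star D x) i \<le> next_pot s i"
proof -
  have fin: "finite (dom (labels s))" and z: "z_part D x \<in> dom (labels s)"
    using assms by (auto simp: state_inv_def)
  have "0 \<le> pot s - pot_at s (z_part D x)"
    unfolding pot_split[OF fin z] using pot_at_nonneg[OF assms(1)] eps_false_pos
    by (intro add_nonneg_nonneg sum_nonneg) auto
  moreover have "0 \<le> reserve (the (labels s (z_part D x))) (Suc (calls (the (chains s (z_part D x)))))"
    using eps_false_pos by (simp add: reserve_def)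
  ultimately show ?thesis
    using assms(2) by (simp add: next_pot_def)
qed

lemma next_pot_nonneg:
  "state_inv s \<Longrightarrow> phase s = Processing v x \<theta> q \<Longrightarrow> 0 \<le> next_pot s i"
  by (rule order_trans[OF _ fail_cost_le_next_pot]) (auto simp: fail_cost_nonneg)

text \<open>A certificate requires a risk value of at most 1, so the price \<open>1 / r\<close> is
  at least 1.\<close>

lemma next_pot_false_cert:
  assumes "false_cert s i" "state_inv s"
  shows "1 \<le> next_pot s i"
proof -
  obtain v x \<theta> q where *: "phase s = Processing v x \<theta> q" "Q D x (scen D i) \<le> \<theta>"
    "next_risk s x q \<le> 1" "\<theta> < Q_star D x"
    using assms(1) by (auto simp: false_cert_def risk_after_call)
  have "1 \<le> fail_cost s x \<theta> q"
    using *(3,4) next_risk_pos[OF assms(2) *(1)] by (simp add: fail_cost_def Let_def le_max_iff_disj)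
  moreover have "i \<notin> I_star D x"
    using *(2,4) by (simp add: I_star_iff)
  ultimately show ?thesis
    using fail_cost_le_next_pot[OF assms(2) *(1), of i] by simp
qed

lemma pot_init: "bc_init D s \<Longrightarrow> pot s = eps_false A"
  by (simp add: bc_init_def pot_def)

end

section \<open>Random executions\<close>

locale bc_random = separation_oracle D A + prob_space M
  for D :: "('n::finite, 'y::finite, 'r::finite, 'u::finite, 'i::finite) two_stage"
    and A :: "('n, 'i) oracle_spec"
    and M :: "'w measure" +
  fixes F :: "nat \<Rightarrow> 'w measure"
    and S :: "nat \<Rightarrow> 'w \<Rightarrow> (real ^ 'n, real ^ 'r, 'i) bc_state"
    and I :: "nat \<Rightarrow> 'w \<Rightarrow> 'i"
  assumes execution: "bc_execution D A M F S I"
    and path: "AE \<omega> in M. bc_path D A (\<lambda>t. S t \<omega>) (\<lambda>t. I t \<omega>)"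
begin

lemma filt: "filtration (space M) F" and subalg: "subalgebra M (F t)"
  and S_measurable: "S t \<in> F t \<rightarrow>\<^sub>M count_space UNIV"
  and I_measurable: "I t \<in> F (Suc t) \<rightarrow>\<^sub>M count_space UNIV"
  using execution by (simp_all add: bc_execution_def)

lemma measurable_mono: "t \<le> t' \<Longrightarrow> f \<in> F t \<rightarrow>\<^sub>M N \<Longrightarrow> f \<in> F t' \<rightarrow>\<^sub>M N"
  using filtration.sets_F_mono[OF filt, of t t'] filtration.space_F[OF filt]
  by (auto simp: measurable_def)

lemma measurable_M: "f \<in> F t \<rightarrow>\<^sub>M N \<Longrightarrow> f \<in> M \<rightarrow>\<^sub>M N"
  by (rule measurable_from_subalg[OF subalg])

text \<open>Strictly earlier steps only: the sample of step \<open>t\<close> is not yet known to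
  \<open>F t\<close>.\<close>

definition failed :: "nat \<Rightarrow> 'w \<Rightarrow> bool" where
  "failed t \<omega> \<longleftrightarrow> (\<exists>t'<t. false_cert (S t' \<omega>) (I t' \<omega>))"

lemma state_measurable: "(\<lambda>\<omega>. h (S t \<omega>)) \<in> F t \<rightarrow>\<^sub>M count_space UNIV"
  by (rule measurable_compose[OF S_measurable]) simp

lemma false_cert_measurable: "Measurable.pred (F (Suc t)) (\<lambda>\<omega>. false_cert (S t \<omega>) (I t \<omega>))"
  by (rule measurable_compose_countable[OF _ I_measurable])
     (rule measurable_mono[OF _ state_measurable], simp)

lemma failed_measurable: "Measurable.pred (F t) (failed t)"
proof -
  have "Measurable.pred (F t) (\<lambda>\<omega>. \<exists>t'\<in>{..<t}. false_cert (S t' \<omega>) (I t' \<omega>))"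
    by (intro pred_intros_countable_bounded measurable_mono[OF _ false_cert_measurable]) auto
  moreover have "failed t = (\<lambda>\<omega>. \<exists>t'\<in>{..<t}. false_cert (S t' \<omega>) (I t' \<omega>))"
    by (auto simp: failed_def fun_eq_iff)
  ultimately show ?thesis
    by simp
qed

text \<open>Truncation gives integrability at once. Taking the minimum with 1 is concave and keeps
  the supermartingale property; the lower bound makes the estimates hold at every sample
  point.\<close>

definition clamp :: "real \<Rightarrow> real" where
  "clamp u = max 0 (min 1 u)"

lemma clamp_bounds: "0 \<le> clamp u" "clamp u \<le> 1"
  by (simp_all add: clamp_def)

lemma clamp_mono: "u \<le> v \<Longrightarrow> clamp u \<le> clamp v"
  by (auto simp: clamp_def)

lemma state_clamp_measurable: "(\<lambda>\<omega>. clamp (h (S t \<omega>))) \<in> borel_measurable (F t)"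
  by (rule measurable_compose[OF S_measurable]) simp

text \<open>Frozen at 1 from the first false certificate on, so that its expectation bounds the
  probability of having failed so far.\<close>

definition level :: "nat \<Rightarrow> 'w \<Rightarrow> real" where
  "level t \<omega> = (if failed t \<omega> then 1 else clamp (pot (S t \<omega>)))"

lemma level_measurable: "level t \<in> borel_measurable (F t)"
  unfolding level_def
  by (intro measurable_If failed_measurable[THEN predE] state_clamp_measurable borel_measurable_const)

lemma level_bounds: "0 \<le> level t \<omega>" "level t \<omega> \<le> 1"
  using clamp_bounds by (simp_all add: level_def)

lemma integrable_bounded:
  fixes f :: "'w \<Rightarrow> real"
  assumes "f \<in> borel_measurable (F t)" "\<And>\<omega>. 0 \<le> f \<omega>" "\<And>\<omega>. f \<omega> \<le> 1"
  shows "integrable M f"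
  by (rule integrable_const_bound[of _ 1]) (use assms in \<open>auto intro: measurable_M\<close>)

definition in_call :: "nat \<Rightarrow> 'w \<Rightarrow> bool" where
  "in_call t \<omega> \<longleftrightarrow> phase (S t \<omega>) \<noteq> Explore"

text \<open>For each fixed \<open>i\<close> this is measurable before the sample is drawn, so it can
  be pulled out of the conditional expectation.\<close>

definition call_level :: "nat \<Rightarrow> 'i \<Rightarrow> 'w \<Rightarrow> real" where
  "call_level t i \<omega> = (if in_call t \<omega> then
     (if failed t \<omega> then 1 else clamp (next_pot (S t \<omega>) i)) else 0)"

definition idle_level :: "nat \<Rightarrow> 'w \<Rightarrow> real" where
  "idle_level t \<omega> = (if in_call t \<omega> then 0 else level t \<omega>)"

lemma in_call_measurable: "Measurable.pred (F t) (in_call t)"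
  unfolding in_call_def by (rule state_measurable)

lemma call_level_measurable: "call_level t i \<in> borel_measurable (F t)"
  unfolding call_level_def
  by (intro measurable_If in_call_measurable[THEN predE] failed_measurable[THEN predE]
      state_clamp_measurable borel_measurable_const)

lemma idle_level_measurable: "idle_level t \<in> borel_measurable (F t)"
  unfolding idle_level_def
  by (intro measurable_If in_call_measurable[THEN predE] level_measurable borel_measurable_const)

lemma call_level_bounds: "0 \<le> call_level t i \<omega>" "call_level t i \<omega> \<le> 1"
  using clamp_bounds by (simp_all add: call_level_def)

lemma level_Suc_le:
  assumes "bc_path D A (\<lambda>t. S t \<omega>) (\<lambda>t. I t \<omega>)"
  shows "level (Suc t) \<omega> \<le> idle_level t \<omega> + call_level t (I t \<omega>) \<omega>"
proof -
  interpret path: bc_path D A "\<lambda>t. S t \<omega>" "\<lambda>t. I t \<omega>"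
    by (rule assms)
  have failed_Suc: "failed (Suc t) \<omega> \<longleftrightarrow> failed t \<omega> \<or> false_cert (S t \<omega>) (I t \<omega>)"
    by (auto simp: failed_def less_Suc_eq)
  have le: "pot (S (Suc t) \<omega>) \<le> next_pot (S t \<omega>) (I t \<omega>)"
    by (rule pot_step[OF path.step path.state_inv])
  show ?thesis
  proof (cases "in_call t \<omega>")
    case True
    have "level (Suc t) \<omega> \<le> (if failed t \<omega> then 1 else clamp (next_pot (S t \<omega>) (I t \<omega>)))"
      using next_pot_false_cert[OF _ path.state_inv] clamp_mono[OF le]
      by (auto simp: level_def failed_Suc clamp_def)
    then show ?thesis
      using True by (simp add: idle_level_def call_level_def)
  next
    case False
    then have "next_pot (S t \<omega>) (I t \<omega>) = pot (S t \<omega>)" "\<not> false_cert (S t \<omega>) (I t \<omega>)"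
      by (auto simp: in_call_def next_pot_def false_cert_def)
    then show ?thesis
      using False clamp_mono[OF le]
      by (simp add: idle_level_def call_level_def level_def failed_Suc)
  qed
qed

lemma call_level_expectation:
  assumes "bc_path D A (\<lambda>t. S t \<omega>) (\<lambda>t. I t \<omega>)" "phase (S t \<omega>) = Processing v x \<theta> q"
  shows "(\<Sum>i\<in>UNIV. call_level t i \<omega> * pmf (call_law D A (S t \<omega>) x) i) \<le> level t \<omega>"
proof -
  interpret path: bc_path D A "\<lambda>t. S t \<omega>" "\<lambda>t. I t \<omega>"
    by (rule assms)
  let ?p = "pmf (call_law D A (S t \<omega>) x)" and ?s = "S t \<omega>"
  have in_call: "in_call t \<omega>"
    using assms(2) by (simp add: in_call_def)
  show ?thesis
  proof (cases "failed t \<omega>")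
    case True
    then show ?thesis
      using in_call by (simp add: call_level_def level_def sum_pmf_UNIV)
  next
    case False
    have "(\<Sum>i\<in>UNIV. call_level t i \<omega> * ?p i) = (\<Sum>i\<in>UNIV. ?p i * clamp (next_pot ?s i))"
      using in_call False by (simp add: call_level_def mult.commute)
    moreover have "\<dots> \<le> (\<Sum>i\<in>UNIV. ?p i * next_pot ?s i)"
      using next_pot_nonneg[OF path.state_inv assms(2)]
      by (intro sum_mono mult_left_mono) (auto simp: clamp_def)
    moreover have "\<dots> \<le> pot ?s"
      by (rule next_pot_expectation[OF path.state_inv assms(2)])
    moreover have "(\<Sum>i\<in>UNIV. ?p i * clamp (next_pot ?s i)) \<le> (\<Sum>i\<in>UNIV. ?p i * 1)"
      by (intro sum_mono mult_left_mono clamp_bounds) simp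
    ultimately show ?thesis
      using False by (simp add: level_def clamp_def sum_pmf_UNIV)
  qed
qed

lemma level_supermartingale: "expectation (level (Suc t)) \<le> expectation (level t)"
proof -
  interpret sigma_finite_subalgebra M "F t"
    by (intro finite_measure_subalgebra_is_sigma_finite finite_measure_subalgebra.intro
        finite_measure_subalgebra_axioms.intro subalg finite_measure_axioms)
  let ?ind = "\<lambda>i. indicator {\<omega> \<in> space M. I t \<omega> = i} :: 'w \<Rightarrow> real"
  let ?ce = "\<lambda>i. real_cond_exp M (F t) (?ind i)"
  have sets: "{\<omega> \<in> space M. I t \<omega> = i} \<in> sets M" for i
    using measurable_sets[OF measurable_M[OF I_measurable], of "{i}" t]
    by (simp add: vimage_def Int_def conj_commute)
  have ind: "?ind i \<in> borel_measurable M" for i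
    using sets by simp
  have call_M: "call_level t i \<in> borel_measurable M" for i
    by (rule measurable_M[OF call_level_measurable])
  have int_call: "integrable M (\<lambda>\<omega>. call_level t i \<omega> * ?ind i \<omega>)" for i
  proof (rule integrable_const_bound[of _ 1])
    show "AE \<omega> in M. norm (call_level t i \<omega> * ?ind i \<omega>) \<le> 1"
      using call_level_bounds[of t i] by (auto simp: indicator_def)
  qed (intro borel_measurable_times call_M ind)
  have int_idle: "integrable M (idle_level t)"
    by (rule integrable_bounded[OF idle_level_measurable])
       (simp_all add: idle_level_def level_bounds)
  have int_level: "integrable M (level t)" for t
    by (rule integrable_bounded[OF level_measurable level_bounds])
  have "expectation (level (Suc t))
      \<le> expectation (\<lambda>\<omega>. idle_level t \<omega> + (\<Sum>i\<in>UNIV. call_level t i \<omega> * ?ind i \<omega>))"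
  proof (rule integral_mono_AE)
    show "AE \<omega> in M. level (Suc t) \<omega>
        \<le> idle_level t \<omega> + (\<Sum>i\<in>UNIV. call_level t i \<omega> * ?ind i \<omega>)"
      using path AE_space
    proof eventually_elim
      case (elim \<omega>)
      have "(\<Sum>i\<in>UNIV. call_level t i \<omega> * ?ind i \<omega>) = (\<Sum>i\<in>{I t \<omega>}. call_level t i \<omega>)"
        using elim(2) by (intro sum.mono_neutral_cong_right) (auto simp: indicator_def)
      then show ?case
        using level_Suc_le[OF elim(1), of t] by simp
    qed
  qed (intro int_level Bochner_Integration.integrable_add Bochner_Integration.integrable_sum
        int_idle int_call)+
  also have "\<dots> = expectation (idle_level t) + (\<Sum>i\<in>UNIV. expectation (\<lambda>\<omega>. call_level t i \<omega> * ?ind i \<omega>))"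
    by (simp only: Bochner_Integration.integral_add[OF int_idle
          Bochner_Integration.integrable_sum[OF int_call]] Bochner_Integration.integral_sum[OF int_call])
  \<comment> \<open>The indicator of each sample value is replaced by its conditional probability,
    which the execution identifies with the law of the call.\<close>
  also have "\<dots> = expectation (idle_level t) + (\<Sum>i\<in>UNIV. expectation (\<lambda>\<omega>. call_level t i \<omega> * ?ce i \<omega>))"
    by (simp only: real_cond_exp_intg(2)[OF int_call call_level_measurable ind])
  also have "\<dots> = expectation (\<lambda>\<omega>. idle_level t \<omega> + (\<Sum>i\<in>UNIV. call_level t i \<omega> * ?ce i \<omega>))"
    using int_idle real_cond_exp_intg(1)[OF int_call call_level_measurable ind] by simp
  also have "\<dots> \<le> expectation (level t)"
  proof (rule integral_mono_AE)
    have law: "AE \<omega> in M. \<forall>v x \<theta> q. phase (S t \<omega>) = Processing v x \<theta> q \<longrightarrow>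
        ?ce i \<omega> = pmf (call_law D A (S t \<omega>) x) i" for i
      using execution by (simp add: bc_execution_def)
    have "AE \<omega> in M. \<forall>i. \<forall>v x \<theta> q. phase (S t \<omega>) = Processing v x \<theta> q \<longrightarrow>
        ?ce i \<omega> = pmf (call_law D A (S t \<omega>) x) i"
      by (rule AE_all_countable[THEN iffD2]) (use law in blast)
    with path show "AE \<omega> in M. idle_level t \<omega> + (\<Sum>i\<in>UNIV. call_level t i \<omega> * ?ce i \<omega>) \<le> level t \<omega>"
    proof eventually_elim
      case (elim \<omega>)
      show ?case
      proof (cases "phase (S t \<omega>)")
        case Explore
        then show ?thesis
          by (simp add: idle_level_def call_level_def in_call_def)
      next
        case (Processing v x \<theta> q)
        then have "?ce i \<omega> = pmf (call_law D A (S t \<omega>) x) i" for i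
          using elim(2) by blast
        then show ?thesis
          using call_level_expectation[OF elim(1) Processing] Processing
          by (simp add: idle_level_def in_call_def)
      qed
    qed
  qed (intro int_level Bochner_Integration.integrable_add Bochner_Integration.integrable_sum
        int_idle real_cond_exp_intg(1) int_call call_level_measurable ind)+
  finally show ?thesis .
qed

lemma expectation_level_le: "expectation (level t) \<le> eps_false A"
proof (induction t)
  case 0
  have "expectation (level 0) \<le> expectation (\<lambda>_. eps_false A)"
  proof (rule integral_mono_AE)
    show "AE \<omega> in M. level 0 \<omega> \<le> eps_false A"
      using path
    proof eventually_elim
      case (elim \<omega>)
      interpret path: bc_path D A "\<lambda>t. S t \<omega>" "\<lambda>t. I t \<omega>"
        by (rule elim)
      show ?case
        using pot_init[OF path.init] eps_false_pos
        by (simp add: level_def failed_def clamp_def)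
    qed
    show "integrable M (level 0)"
      by (rule integrable_bounded[OF level_measurable level_bounds])
  qed simp
  then show ?case
    by (simp add: prob_space)
next
  case (Suc t)
  then show ?case
    using level_supermartingale[of t] by simp
qed

lemma failed_events: "{\<omega> \<in> space M. failed t \<omega>} \<in> events"
  using measurable_M[OF failed_measurable[of t]] by (simp add: pred_def)

lemma prob_failed_le: "prob {\<omega> \<in> space M. failed t \<omega>} \<le> eps_false A"
proof -
  have "prob {\<omega> \<in> space M. failed t \<omega>} = expectation (indicator {\<omega> \<in> space M. failed t \<omega>})"
    using failed_events by simp
  also have "\<dots> \<le> expectation (level t)"
  proof (rule integral_mono)
    show "integrable M (level t)"
      by (rule integrable_bounded[OF level_measurable level_bounds])
    show "integrable M (indicator {\<omega> \<in> space M. failed t \<omega>} :: 'w \<Rightarrow> real)"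
      by (rule integrable_const_bound[of _ 1]) (use failed_events in auto)
    show "indicator {\<omega> \<in> space M. failed t \<omega>} \<omega> \<le> level t \<omega>" for \<omega>
      using level_bounds[of t \<omega>] by (auto simp: indicator_def level_def)
  qed
  finally show ?thesis
    using expectation_level_le[of t] by simp
qed

lemma prob_ever_failed_le: "prob {\<omega> \<in> space M. \<exists>t. failed t \<omega>} \<le> eps_false A"
proof -
  have "(\<lambda>t. prob {\<omega> \<in> space M. failed t \<omega>}) \<longlonglongrightarrow> prob (\<Union>t. {\<omega> \<in> space M. failed t \<omega>})"
  proof (rule finite_Lim_measure_incseq)
    show "range (\<lambda>t. {\<omega> \<in> space M. failed t \<omega>}) \<subseteq> events"
      using failed_events by blast
    show "incseq (\<lambda>t. {\<omega> \<in> space M. failed t \<omega>})"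
      by (auto simp: incseq_def failed_def dest: less_le_trans)
  qed
  then have "prob (\<Union>t. {\<omega> \<in> space M. failed t \<omega>}) \<le> eps_false A"
    by (rule LIMSEQ_le_const2) (use prob_failed_le in blast)
  moreover have "(\<Union>t. {\<omega> \<in> space M. failed t \<omega>}) = {\<omega> \<in> space M. \<exists>t. failed t \<omega>}"
    by blast
  ultimately show ?thesis
    by simp
qed

lemma success_prob:
  fixes P :: "(real ^ 'n, real ^ 'r, 'i) bc_state \<Rightarrow> bool"
  assumes "\<And>S I. bc_path D A S I \<Longrightarrow> (\<And>t. \<not> false_cert (S t) (I t)) \<Longrightarrow> \<exists>t. P (S t)"
  shows "1 - eps_false A \<le> prob {\<omega> \<in> space M. \<exists>t. P (S t \<omega>)}"
proof -
  let ?E = "{\<omega> \<in> space M. \<exists>t. failed t \<omega>}" and ?G = "{\<omega> \<in> space M. \<exists>t. P (S t \<omega>)}"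
  have E: "?E \<in> events"
  proof -
    have "?E = (\<Union>t. {\<omega> \<in> space M. failed t \<omega>})"
      by blast
    then show ?thesis
      using failed_events by auto
  qed
  have G: "?G \<in> events"
  proof -
    have "{\<omega> \<in> space M. P (S t \<omega>)} \<in> events" for t
      using measurable_M[OF state_measurable[of P t]] by (simp add: pred_def)
    moreover have "?G = (\<Union>t. {\<omega> \<in> space M. P (S t \<omega>)})"
      by blast
    ultimately show ?thesis
      by auto
  qed
  have "1 - prob ?E = prob (space M - ?E)"
    using E by (simp add: prob_compl)
  also have "\<dots> \<le> prob ?G"
  proof (rule finite_measure_mono_AE[OF _ G])
    show "AE \<omega> in M. \<omega> \<in> space M - ?E \<longrightarrow> \<omega> \<in> ?G"
      using path
    proof eventually_elim
      case (elim \<omega>)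
      then show ?case
        using assms[OF elim] by (auto simp: failed_def)
    qed
  qed
  finally show ?thesis
    using prob_ever_failed_le by linarith
qed

end

theorem theorem5:
  fixes D :: "('n::finite, 'y::finite, 'r::finite, 'u::finite, 'i::finite) two_stage"
    and A :: "('n, 'i) oracle_spec"
    and M :: "'w measure"
    and F :: "nat \<Rightarrow> 'w measure"
    and S :: "nat \<Rightarrow> 'w \<Rightarrow> (real ^ 'n, real ^ 'r, 'i) bc_state"
    and I :: "nat \<Rightarrow> 'w \<Rightarrow> 'i"
    and L_P :: real
  assumes scenarios: "CARD('i) \<ge> 2"
    and integrality: "\<forall>x\<in>feas D. \<forall>i\<in>int_vars D. x $ i \<in> \<int>"
    and recourse_finite: "\<forall>x\<in>feas D. \<forall>i. Q_finite D x (scen D i)"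
    and min_attained: "\<exists>x. is_arg_min (\<lambda>x. obj D x + Q_star D x) (\<lambda>x. x \<in> feas D) x"
    and score_accuracy: "\<forall>x\<in>feas D. \<forall>i. \<bar>score A x i - Q D x (scen D i)\<bar> \<le> eps A"
    and score_lipschitz: "\<forall>x\<in>feas D. \<forall>x'\<in>feas D. \<forall>i.
          \<bar>score A x i - score A x' i\<bar> \<le> L_Q A * norm (x - x')"
    and "L_Q A > 0"
    and kernel_invariance: "\<forall>x\<in>feas D. kernel_invariant (kern A x) (softmax A x)"
    and kernel_lipschitz: "\<forall>x\<in>feas D. \<forall>x'\<in>feas D.
          (SUP i. tv_dist (kern A x i) (kern A x' i)) \<le> L_P * norm (x - x')"
    and kernel_contraction: "\<forall>x\<in>feas D.
          (SUP (i, j). tv_dist (kern A x i) (kern A x j)) \<le> eta A"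
    and "0 < eta A" "eta A < 1"
    and "Delta A > 4 * eps A"
    and "0 < temp A"
    and "temp A \<le> (Delta A - 2 * eps A) / ln (2 * (real CARD('i) - 1) / (1 - eta A))"
    and "decay A > 0" "c0 A > 0"
    and "0 < eps_false A" "eps_false A < 1"
    and "eps_opt A > 0"
    and "prob_space M"
    and execution: "bc_execution D A M F S I"
    and score_gap: "AE \<omega> in M. \<forall>t v x \<theta> q. phase (S t \<omega>) = Processing v x \<theta> q \<longrightarrow>
          (\<forall>j. j \<notin> I_star D x \<longrightarrow> Q_star D x - Q D x (scen D j) \<ge> Delta A)"
    and finite_tree: "AE \<omega> in M. finite (\<Union>t. created (S t \<omega>))"
  shows "(AE \<omega> in M. \<exists>t. stopped A (S t \<omega>)) \<and>
    measure M {\<omega> \<in> space M. \<exists>t x \<theta>. stopped A (S t \<omega>) \<and> best (S t \<omega>) = Some (x, \<theta>) \<and>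
        0 \<le> (obj D x + \<theta>) - F_star D \<and> (obj D x + \<theta>) - F_star D \<le> eps_opt A}
      \<ge> 1 - eps_false A"
proof -
  interpret separation_oracle D A
    using assms by unfold_locales auto
  interpret prob_space M
    by (rule \<open>prob_space M\<close>)
  have path: "AE \<omega> in M. bc_path D A (\<lambda>t. S t \<omega>) (\<lambda>t. I t \<omega>)"
  proof -
    have "AE \<omega> in M. bc_run D A (\<lambda>t. S t \<omega>) (\<lambda>t. I t \<omega>)"
      using execution by (simp add: bc_execution_def)
    then show ?thesis
      using score_gap finite_tree
    proof eventually_elim
      case (elim \<omega>)
      have "Delta A \<le> Q_star D x - Q D x (scen D j)"
        if "phase (S t \<omega>) = Processing v x \<theta> q" "j \<notin> I_star D x" for t v x \<theta> q j
        using elim(2) that by blast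
      then show ?case
        using elim(1,3) recourse_finite by unfold_locales auto
    qed
  qed
  interpret bc_random D A M F S I
    using execution path by unfold_locales
  obtain x0 where x0: "is_arg_min (\<lambda>x. obj D x + Q_star D x) (\<lambda>x. x \<in> feas D) x0"
    using min_attained by blast
  show ?thesis
  proof
    show "AE \<omega> in M. \<exists>t. stopped A (S t \<omega>)"
      using path by eventually_elim (rule bc_path.terminates)
    have "1 - eps_false A \<le> prob {\<omega> \<in> space M. \<exists>t. \<exists>x \<theta>.
        stopped A (S t \<omega>) \<and> best (S t \<omega>) = Some (x, \<theta>) \<and>
        0 \<le> (obj D x + \<theta>) - F_star D \<and> (obj D x + \<theta>) - F_star D \<le> eps_opt A}"
      by (rule success_prob, rule bc_path.returned_solution[OF _ x0])
    then show "measure M {\<omega> \<in> space M. \<exists>t x \<theta>. stopped A (S t \<omega>) \<and> best (S t \<omega>) = Some (x, \<theta>) \<and>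
        0 \<le> (obj D x + \<theta>) - F_star D \<and> (obj D x + \<theta>) - F_star D \<le> eps_opt A}
      \<ge> 1 - eps_false A"
      by simp
  qed
qed

end
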